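(* Let $\Omega_1\subseteq\Omega_2\subseteq\cdots\subseteq\Omega_d$ be compact intervals of $\mathbb{R}$, $\Omega=\Omega_1\times\cdots\times\Omega_d$, and let $f:\mathbb{R}^d\to\mathbb{R}$ be continuous. Suppose that $\mathcal{M}_{\boldsymbol{\nu}}(\varepsilon)\neq\varnothing$ for some $\boldsymbol{\nu}=(\nu_1,\dots,\nu_d)\in\mathcal{P}(\Omega_1)\times\cdots\times\mathcal{P}(\Omega_d)$ and some $\varepsilon>0$. Set $$I_{\boldsymbol{\nu}}(\varepsilon)=\sup_{\pi\in\mathcal{M}_{\boldsymbol{\nu}}(\varepsilon)}\mathbb{E}_\pi[f(\mathbf{X})],\qquad J_{\boldsymbol{\nu}}(\varepsilon)=\inf\Big\{\gamma\varepsilon+\sum_{k=1}^d\int_{\Omega_k}\beta_k(x_k)\,\nu_k(dx_k)\Big\},$$ where the infimum is over all $\gamma\in\mathbb{R}_{\ge0}$, $\boldsymbol{\alpha}=(\alpha_1,\dots,\alpha_{d-1})$ with $\alpha_k\in C(\Omega_1\times\cdots\times\Omega_k)$ for $1\le k\le d-1$, and $\boldsymbol{\beta}=(\beta_1,\dots,\beta_d)$ with $\beta_k\in C(\Omega_k)$ for $1\le k\le d$, such that for all $\mathbf{x}=(x_1,\dots,x_d)\in\Omega$ and $\mathbf{x}'=(x_1',\dots,x_d')\in\Omega$, $$f(\mathbf{x}')+\sum_{k=1}^{d-1}\alpha_k(x_1',\dots,x_k')(x_{k+1}'-x_k')-\gamma\|\mathbf{x}-\mathbf{x}'\|_1-\sum_{k=1}^d\beta_k(x_k)\le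 0.$$ Then strong duality $I_{\boldsymbol{\nu}}(\varepsilon)=J_{\boldsymbol{\nu}}(\varepsilon)$ holds, and there exists a primal optimizer, i.e. a measure $\pi^{\mathrm{DRO}}\in\mathcal{M}_{\boldsymbol{\nu}}(\varepsilon)$ with $\mathbb{E}_{\pi^{\mathrm{DRO}}}[f(\mathbf{X})]=I_{\boldsymbol{\nu}}(\varepsilon)$.
   Context: $\mathcal{P}(S)$ is the set of Borel probability measures on $S$; $C(S)$ is the set of real continuous functions on $S$. $\mathbf{X}=(X_1,\dots,X_d)$ is the canonical (identity) map on $\Omega$, $\mathbb{E}_\pi$ is expectation when $\mathbf{X}\sim\pi$. $\mathcal{M}(\Omega)$ is the set of martingale measures on $\Omega$: all $\pi\in\mathcal{P}(\Omega)$ with $\mathbb{E}_\pi[X_{k+1}\mid\sigma(X_1,\dots,X_k)]=X_k$ $\pi$-a.e. for $1\le k\le d-1$. $\Pi(\boldsymbol{\nu})$ is the set of probability measures on $\Omega$ whose $i$-th marginal is $\nu_i$ for $1\le i\le d$. $\mathcal{W}(\mu,\nu)=\inf\{\int\|\mathbf{x}-\mathbf{y}\|_1\,\pi(d\mathbf{x},d\mathbf{y})\}$, the infimum over couplings $\pi$ of $\mu$ and $\nu$, is the Wasserstein distance with $\ell_1$ cost, where $\|\mathbf{z}\|_1=\sum_i|z_i|$. $d(\pi,\Pi(\boldsymbol{\nu}))=\inf\{\mathcal{W}(\pi,\pi'):\pi'\in\Pi(\boldsymbol{\nu})\}$. $\mathcal{M}_{\boldsymbol{\nu}}(\varepsilon)=\{\pi\in\mathcal{M}(\Omega):d(\pi,\Pi(\boldsymbol{\nu}))\le\varepsilon\}$.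 *)

theory Defs
  imports "HOL-Probability.Probability"
begin

text \<open>
  A point of \<open>\<real>\<^sup>d\<close> is an extensional function in \<open>{1..d} \<rightarrow>\<^sub>E UNIV\<close>. The type
  \<^typ>\<open>nat \<Rightarrow> real\<close> carries the product topology, and all coordinates outside \<open>{1..d}\<close>
  of such a point are fixed, so its subspace topology on \<open>{1..d} \<rightarrow>\<^sub>E UNIV\<close> is the
  usual topology of \<open>\<real>\<^sup>d\<close>.
\<close>

definition borel_probs :: "'a::topological_space set \<Rightarrow> 'a measure set" where
  "borel_probs S = {\<mu>. prob_space \<mu> \<and> sets \<mu> = sets (restrict_space borel S)}"

definition omega_prod :: "nat \<Rightarrow> (nat \<Rightarrow> real set) \<Rightarrow> (nat \<Rightarrow> real) set" where
  "omega_prod k \<Omega> = (\<Pi>\<^sub>E i\<in>{1..k}. \<Omega> i)"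

definition l1_dist :: "nat \<Rightarrow> (nat \<Rightarrow> real) \<Rightarrow> (nat \<Rightarrow> real) \<Rightarrow> real" where
  "l1_dist d x y = (\<Sum>i=1..d. \<bar>x i - y i\<bar>)"

definition coord_algebra :: "(nat \<Rightarrow> real) set \<Rightarrow> nat \<Rightarrow> (nat \<Rightarrow> real) measure" where
  "coord_algebra S k =
     vimage_algebra S (\<lambda>x. restrict x {1..k}) (\<Pi>\<^sub>M i\<in>{1..k}. borel)"

definition martingale_measures ::
    "nat \<Rightarrow> (nat \<Rightarrow> real set) \<Rightarrow> (nat \<Rightarrow> real) measure set" where
  "martingale_measures d \<Omega> =
     {\<pi> \<in> borel_probs (omega_prod d \<Omega>).
        \<forall>k\<in>{1..<d}. AE x in \<pi>.
          real_cond_exp \<pi> (coord_algebra (omega_prod d \<Omega>) k) (\<lambda>x. x (Suc k)) x = x k}"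

definition with_marginals ::
    "nat \<Rightarrow> (nat \<Rightarrow> real set) \<Rightarrow> (nat \<Rightarrow> real measure) \<Rightarrow> (nat \<Rightarrow> real) measure set" where
  "with_marginals d \<Omega> \<nu> =
     {\<pi> \<in> borel_probs (omega_prod d \<Omega>).
        \<forall>i\<in>{1..d}. distr \<pi> (restrict_space borel (\<Omega> i)) (\<lambda>x. x i) = \<nu> i}"

definition couplings :: "'a measure \<Rightarrow> 'b measure \<Rightarrow> ('a \<times> 'b) measure set" where
  "couplings \<mu> \<nu> =
     {\<pi>. prob_space \<pi> \<and> sets \<pi> = sets (\<mu> \<Otimes>\<^sub>M \<nu>) \<and>
          distr \<pi> \<mu> fst = \<mu> \<and> distr \<pi> \<nu> snd = \<nu>}"

text \<open>
  The infima are taken in \<^typ>\<open>ennreal\<close>, and those of the primal and dual values in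
  \<^typ>\<open>ereal\<close>, so that no nonemptiness or boundedness is built into the definitions.
\<close>

definition wasserstein ::
    "nat \<Rightarrow> (nat \<Rightarrow> real) measure \<Rightarrow> (nat \<Rightarrow> real) measure \<Rightarrow> ennreal" where
  "wasserstein d \<mu> \<nu> =
     (INF \<pi>\<in>couplings \<mu> \<nu>. \<integral>\<^sup>+ z. ennreal (l1_dist d (fst z) (snd z)) \<partial>\<pi>)"

definition dist_to_marginals ::
    "nat \<Rightarrow> (nat \<Rightarrow> real set) \<Rightarrow> (nat \<Rightarrow> real measure) \<Rightarrow> (nat \<Rightarrow> real) measure \<Rightarrow> ennreal" where
  "dist_to_marginals d \<Omega> \<nu> \<pi> = (INF \<pi>'\<in>with_marginals d \<Omega> \<nu>. wasserstein d \<pi> \<pi>')"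

definition martingale_ball ::
    "nat \<Rightarrow> (nat \<Rightarrow> real set) \<Rightarrow> (nat \<Rightarrow> real measure) \<Rightarrow> real \<Rightarrow> (nat \<Rightarrow> real) measure set" where
  "martingale_ball d \<Omega> \<nu> \<epsilon> =
     {\<pi> \<in> martingale_measures d \<Omega>. dist_to_marginals d \<Omega> \<nu> \<pi> \<le> ennreal \<epsilon>}"

definition primal_value ::
    "nat \<Rightarrow> (nat \<Rightarrow> real set) \<Rightarrow> ((nat \<Rightarrow> real) \<Rightarrow> real) \<Rightarrow> (nat \<Rightarrow> real measure) \<Rightarrow> real \<Rightarrow> ereal" where
  "primal_value d \<Omega> f \<nu> \<epsilon> =
     (SUP \<pi>\<in>martingale_ball d \<Omega> \<nu> \<epsilon>. ereal (\<integral>x. f x \<partial>\<pi>))"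

definition dual_feasible ::
    "nat \<Rightarrow> (nat \<Rightarrow> real set) \<Rightarrow> ((nat \<Rightarrow> real) \<Rightarrow> real) \<Rightarrow>
     (real \<times> (nat \<Rightarrow> (nat \<Rightarrow> real) \<Rightarrow> real) \<times> (nat \<Rightarrow> real \<Rightarrow> real)) set" where
  "dual_feasible d \<Omega> f =
     {(\<gamma>, \<alpha>, \<beta>). 0 \<le> \<gamma> \<and>
        (\<forall>k\<in>{1..<d}. continuous_on (omega_prod k \<Omega>) (\<alpha> k)) \<and>
        (\<forall>k\<in>{1..d}. continuous_on (\<Omega> k) (\<beta> k)) \<and>
        (\<forall>x\<in>omega_prod d \<Omega>. \<forall>x'\<in>omega_prod d \<Omega>.
           f x' + (\<Sum>k\<in>{1..<d}. \<alpha> k (restrict x' {1..k}) * (x' (Suc k) - x' k))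
             - \<gamma> * l1_dist d x x' - (\<Sum>k=1..d. \<beta> k (x k)) \<le> 0)}"

definition dual_value ::
    "nat \<Rightarrow> (nat \<Rightarrow> real set) \<Rightarrow> ((nat \<Rightarrow> real) \<Rightarrow> real) \<Rightarrow> (nat \<Rightarrow> real measure) \<Rightarrow> real \<Rightarrow> ereal" where
  "dual_value d \<Omega> f \<nu> \<epsilon> =
     (INF (\<gamma>, \<alpha>, \<beta>)\<in>dual_feasible d \<Omega> f.
        ereal (\<gamma> * \<epsilon> + (\<Sum>k=1..d. \<integral>t. \<beta> k t \<partial>\<nu> k)))"

end

theory Submission
  imports Defs
begin

text \<open>
  The problem is a linear program over probability measures \<open>m\<close> on pairs \<open>(x, x')\<close> of paths:
  \<open>x\<close> has marginals \<open>\<nu>\<close>, \<open>x'\<close> is a martingale, the mean transport cost \<open>\<parallel>x - x'\<parallel>\<^sub>1\<close> is at most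
  \<open>\<epsilon>\<close>, and the mean of \<open>f x'\<close> is to be maximised. All these requirements say that
  integrals of continuous functions are \<open>\<le> 0\<close>, and countably many of them suffice: ramps at
  rational thresholds approximate indicators of boxes, and boxes determine both the marginals and the
  martingale property (\<open>finite_measure_eqI_ramp_box\<close>, \<open>martingale_from_ramp_boxes\<close>).

  Weak duality (\<open>weak_duality\<close>) comes from integrating the dual inequality against a coupling that is
  almost optimal. For the converse, fix a real \<open>c\<close> that is at most the dual value, and add the
  requirement \<open>\<integral>f x' \<ge> c\<close>. By a theorem of the alternative (\<open>ville_alternative_countable\<close>), either
  some \<open>m\<close> meets all requirements, or a finite nonnegative combination of the constraint functions is
  bounded below by some \<open>D > 0\<close>. Every such combination is the surplus of a hedge against
  \<open>a \<ge> 0\<close> copies of \<open>f\<close> that costs at most \<open>a c\<close>. If \<open>a > 0\<close>, then skimming off \<open>D\<close> gives a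
  dual point of value below \<open>c\<close>; if \<open>a = 0\<close>, it gives a hedge of the zero claim with a negative price,
  which contradicts weak duality. So \<open>m\<close> exists, and its \<open>x'\<close>-marginal is a primal point with
  expectation at least \<open>c\<close>. The choice of the dual value itself for \<open>c\<close> yields equality and a primal
  optimizer at once.

  The alternative rests on weak sequential compactness of the probability measures on a compact box
  (\<open>weak_seq_compact_borel_probs\<close>). This is transported from the line: Schoenberg's space-filling curve
  has a measurable section, so measures on the box lift to measures on \<open>[0, 1]\<close>, Helly's theorem gives
  a convergent subsequence there, and the curve, being continuous, carries the limit back.
\<close>

section \<open>A space-filling curve with a measurable section\<close>

text \<open>
  A continuous wave of period 2 that is 0 on \<open>[0, 1/3]\<close> and 1 on \<open>[2/3, 1]\<close>: applied to \<open>3\<^sup>j t\<close> it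
  reads off the \<open>j\<close>-th ternary digit of a point \<open>t\<close> of the Cantor set. Clipping a cosine gives the two
  plateaus, because \<open>cos (\<pi> t)\<close> is at least \<open>1/2\<close> on the first interval and at most \<open>-1/2\<close> on the
  second.
\<close>

definition bit_wave :: "real \<Rightarrow> real" where
  "bit_wave t = max 0 (min 1 (1/2 - cos (pi * t)))"

lemma bit_wave_bounds: "0 \<le> bit_wave t" "bit_wave t \<le> 1"
  by (auto simp: bit_wave_def)

lemma continuous_bit_wave: "continuous_on UNIV bit_wave"
  unfolding bit_wave_def by (intro continuous_intros)

lemma bit_wave_eq:
  fixes K :: int
  assumes "b \<in> {0, 1}" "0 \<le> r" "r \<le> 1/3"
  shows "bit_wave (2 * of_int K + 2 * b / 3 + r) = b"
proof -
  have per: "cos (pi * (2 * of_int K + 2 * b / 3 + r)) = cos (pi * (2 * b / 3 + r))"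
  proof -
    have "pi * (2 * of_int K + 2 * b / 3 + r) = pi * (2 * b / 3 + r) + of_int K * (2 * pi)"
      by (simp add: algebra_simps)
    moreover have "cos (of_int K * (2 * pi)) = 1"
      using cos_int_2pin[of K] by (simp add: mult_ac)
    moreover have "sin (of_int K * (2 * pi)) = 0"
      using sin_int_2pin[of K] by (simp add: mult_ac)
    ultimately show ?thesis
      by (simp only: cos_add)
  qed
  have pr: "pi * r \<le> pi / 3" "0 \<le> pi * r"
    using assms(2,3) by (auto simp: field_simps)
  have c: "1/2 \<le> cos (pi * r)"
    using cos_monotone_0_pi_le[of "pi * r" "pi / 3"] pr by (simp add: cos_60)
  have "cos (pi * (2 / 3 + r)) = - cos (pi - pi * (2/3 + r))"
    by simp
  moreover have "1/2 \<le> cos (pi - pi * (2/3 + r))"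
    using cos_monotone_0_pi_le[of "pi - pi * (2/3 + r)" "pi / 3"] pr
    by (simp add: cos_60 algebra_simps)
  ultimately have c': "cos (pi * (2 / 3 + r)) \<le> -1/2"
    by simp
  from assms(1) show ?thesis
    unfolding bit_wave_def per using c c' by auto
qed

definition binary_digit :: "nat \<Rightarrow> real \<Rightarrow> real" where
  "binary_digit n x = of_int (\<lfloor>2 ^ Suc n * x\<rfloor> - 2 * \<lfloor>2 ^ n * x\<rfloor>)"

lemma binary_digit_01: "binary_digit n x \<in> {0, 1}"
proof -
  have "\<lfloor>2 ^ Suc n * x\<rfloor> - 2 * \<lfloor>2 ^ n * x\<rfloor> \<in> {0, 1}"
    unfolding power_Suc mult.assoc by (simp, linarith)
  then show ?thesis unfolding binary_digit_def by auto
qed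

lemma measurable_binary_digit [measurable]: "binary_digit n \<in> borel_measurable borel"
  unfolding binary_digit_def by measurable

text \<open>
  The partial sums telescope to \<open>\<lfloor>2\<^sup>N x\<rfloor> / 2\<^sup>N\<close>.
\<close>

lemma sums_binary_digit:
  assumes "0 \<le> x" "x < 1"
  shows "(\<lambda>n. binary_digit n x / 2 ^ Suc n) sums x"
proof -
  have f0: "\<lfloor>x\<rfloor> = 0" using assms by linarith
  have part: "(\<Sum>n<N. binary_digit n x / 2 ^ Suc n) = of_int \<lfloor>2 ^ N * x\<rfloor> / 2 ^ N" for N
    by (induction N) (auto simp: f0 binary_digit_def field_simps)
  have "(\<lambda>N. of_int \<lfloor>2 ^ N * x\<rfloor> / 2 ^ N) \<longlonglongrightarrow> x"
  proof (rule tendsto_sandwich)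
    show "\<forall>\<^sub>F N in sequentially. x - (1/2) ^ N \<le> of_int \<lfloor>2 ^ N * x\<rfloor> / 2 ^ N"
    proof (rule always_eventually, rule allI)
      fix N
      have "2 ^ N * x - 1 \<le> of_int \<lfloor>2 ^ N * x\<rfloor>" by linarith
      then have "(2 ^ N * x - 1) / 2 ^ N \<le> of_int \<lfloor>2 ^ N * x\<rfloor> / 2 ^ N"
        by (intro divide_right_mono) auto
      then show "x - (1/2) ^ N \<le> of_int \<lfloor>2 ^ N * x\<rfloor> / 2 ^ N"
        by (simp add: diff_divide_distrib power_divide)
    qed
    show "\<forall>\<^sub>F N in sequentially. of_int \<lfloor>2 ^ N * x\<rfloor> / 2 ^ N \<le> x"
    proof (rule always_eventually, rule allI)
      fix N
      have "of_int \<lfloor>2 ^ N * x\<rfloor> \<le> 2 ^ N * x" by linarith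
      then show "of_int \<lfloor>2 ^ N * x\<rfloor> / 2 ^ N \<le> x"
        by (simp add: field_simps)
    qed
    have "(\<lambda>N. x - (1/2) ^ N) \<longlonglongrightarrow> x - 0"
      by (intro tendsto_intros LIMSEQ_power_zero) auto
    then show "(\<lambda>N. x - (1/2) ^ N) \<longlonglongrightarrow> x" by simp
  qed auto
  then show ?thesis unfolding sums_def part .
qed

text \<open>
  The binary digits of all coordinates \<open>y i\<close> are interleaved by the pairing function and written, doubled,
  as ternary digits of one point of the Cantor set.
\<close>

definition cantor_code :: "(nat \<Rightarrow> real) \<Rightarrow> real" where
  "cantor_code y = (\<Sum>j. 2 * binary_digit (snd (prod_decode j)) (y (fst (prod_decode j))) / 3 ^ Suc j)"

text \<open>
  Schoenberg's curve in countably many dimensions: coordinate \<open>i\<close> reads back the digits stored at the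
  positions \<open>prod_encode (i, n)\<close>. The definition makes sense, and is continuous, at every real \<open>t\<close>, not
  only on the Cantor set.
\<close>

definition schoenberg :: "real \<Rightarrow> nat \<Rightarrow> real" where
  "schoenberg t i = (\<Sum>n. bit_wave (3 ^ prod_encode (i, n) * t) / 2 ^ Suc n)"

lemma sums_third: "(\<lambda>j. 2 / 3 ^ Suc j :: real) sums 1"
  using sums_mult[OF geometric_sums[of "1/3::real"], of "2/3"] by (simp add: power_divide)

lemma sums_half: "(\<lambda>j. 1 / 2 ^ Suc j :: real) sums 1"
  using power_half_series by (simp add: power_divide)

lemma cantor_series:
  fixes b :: "nat \<Rightarrow> real"
  assumes "\<And>j. b j \<in> {0, 1}"
  shows "summable (\<lambda>j. 2 * b j / 3 ^ Suc j)" "0 \<le> (\<Sum>j. 2 * b j / 3 ^ Suc j)"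
    "(\<Sum>j. 2 * b j / 3 ^ Suc j) \<le> 1"
proof -
  have b: "0 \<le> b j" "b j \<le> 1" for j using assms[of j] by auto
  show s: "summable (\<lambda>j. 2 * b j / 3 ^ Suc j)"
    by (rule summable_comparison_test'[OF sums_summable[OF sums_third], of 0])
      (use b in \<open>auto simp: divide_right_mono\<close>)
  show "0 \<le> (\<Sum>j. 2 * b j / 3 ^ Suc j)"
    using b by (intro suminf_nonneg[OF s]) auto
  have "(\<Sum>j. 2 * b j / 3 ^ Suc j) \<le> (\<Sum>j. 2 / 3 ^ Suc j)"
    using b by (intro suminf_le[OF _ s sums_summable[OF sums_third]] divide_right_mono) auto
  then show "(\<Sum>j. 2 * b j / 3 ^ Suc j) \<le> 1"
    using sums_unique[OF sums_third] by simp
qed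

text \<open>
  Multiplied by \<open>3\<^sup>j\<close>, the terms before the \<open>j\<close>-th become even integers, which the period absorbs,
  the \<open>j\<close>-th becomes \<open>0\<close> or \<open>2/3\<close>, and the rest sums to a number in \<open>[0, 1/3]\<close>; so the wave is
  evaluated on one of its plateaus.
\<close>

lemma bit_wave_cantor_series:
  fixes b :: "nat \<Rightarrow> real"
  assumes b: "\<And>j. b j \<in> {0, 1}"
  shows "bit_wave (3 ^ j * (\<Sum>m. 2 * b m / 3 ^ Suc m)) = b j"
proof -
  define r where "r = (\<Sum>m. 2 * b (m + Suc j) / 3 ^ Suc m) / 3"
  have "\<exists>K::int. (\<Sum>m<j. 3 ^ j * b m / 3 ^ Suc m) = of_int K"
  proof -
    have "(\<Sum>m<j. 3 ^ j * b m / 3 ^ Suc m) = (\<Sum>m<j. of_int (3 ^ (j - Suc m) * \<lfloor>b m\<rfloor>))"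
    proof (intro sum.cong refl)
      fix m assume "m \<in> {..<j}"
      then have "(3::real) ^ j = 3 ^ (j - Suc m) * 3 ^ Suc m"
        by (subst power_add[symmetric]) auto
      moreover have bm: "of_int \<lfloor>b m\<rfloor> = b m" using b[of m] by auto
      ultimately show "3 ^ j * b m / 3 ^ Suc m = of_int (3 ^ (j - Suc m) * \<lfloor>b m\<rfloor>)"
        unfolding of_int_mult bm by simp
    qed
    also have "\<dots> = of_int (\<Sum>m<j. 3 ^ (j - Suc m) * \<lfloor>b m\<rfloor>)" by simp
    finally show ?thesis by blast
  qed
  then obtain K :: int where K: "(\<Sum>m<j. 3 ^ j * b m / 3 ^ Suc m) = of_int K" by blast
  have tail: "(\<Sum>m. 2 * b (m + Suc j) / 3 ^ Suc (m + Suc j)) = r / 3 ^ j"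
  proof -
    have "(\<Sum>m. 2 * b (m + Suc j) / 3 ^ Suc (m + Suc j))
        = (\<Sum>m. (2 * b (m + Suc j) / 3 ^ Suc m) * (1 / 3 ^ Suc j))"
      by (intro suminf_cong) (simp add: power_add)
    also have "\<dots> = (\<Sum>m. 2 * b (m + Suc j) / 3 ^ Suc m) * (1 / 3 ^ Suc j)"
      using cantor_series(1)[of "\<lambda>m. b (m + Suc j)"] b by (intro suminf_mult2[symmetric]) auto
    finally show ?thesis by (simp add: r_def)
  qed
  have "(\<Sum>m. 2 * b m / 3 ^ Suc m)
      = (\<Sum>m. 2 * b (m + Suc j) / 3 ^ Suc (m + Suc j)) + (\<Sum>m<Suc j. 2 * b m / 3 ^ Suc m)"
    using b by (intro suminf_split_initial_segment cantor_series(1)) auto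
  then have "3 ^ j * (\<Sum>m. 2 * b m / 3 ^ Suc m)
      = 3 ^ j * (r / 3 ^ j) + 3 ^ j * (\<Sum>m<Suc j. 2 * b m / 3 ^ Suc m)"
    unfolding tail by (simp add: distrib_left)
  also have "3 ^ j * (\<Sum>m<Suc j. 2 * b m / 3 ^ Suc m)
      = 2 * (\<Sum>m<j. 3 ^ j * b m / 3 ^ Suc m) + 2 * b j / 3"
    by (simp add: distrib_left sum_distrib_left mult_ac)
  finally have eq: "3 ^ j * (\<Sum>m. 2 * b m / 3 ^ Suc m) = 2 * of_int K + 2 * b j / 3 + r"
    unfolding K[symmetric] by simp
  show ?thesis
    unfolding eq
  proof (rule bit_wave_eq)
    show "0 \<le> r" "r \<le> 1/3"
      using cantor_series(2,3)[of "\<lambda>m. b (m + Suc j)"] b by (auto simp: r_def)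
  qed (rule b)
qed

lemma cantor_code_bounds: "cantor_code y \<in> {0..1}"
  unfolding cantor_code_def
  using cantor_series(2,3)[of "\<lambda>j. binary_digit (snd (prod_decode j)) (y (fst (prod_decode j)))"]
    binary_digit_01 by auto

lemma schoenberg_cantor_code:
  assumes "0 \<le> y i" "y i < 1"
  shows "schoenberg (cantor_code y) i = y i"
proof -
  have "bit_wave (3 ^ prod_encode (i, n) * cantor_code y) = binary_digit n (y i)" for n
    unfolding cantor_code_def
    using bit_wave_cantor_series[of "\<lambda>j. binary_digit (snd (prod_decode j)) (y (fst (prod_decode j)))"
        "prod_encode (i, n)"] binary_digit_01 by simp
  then show ?thesis
    unfolding schoenberg_def using sums_unique[OF sums_binary_digit[OF assms]] by simp
qed

lemma schoenberg_nonneg: "0 \<le> schoenberg t i"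
  unfolding schoenberg_def
  by (intro suminf_nonneg summable_comparison_test'[OF sums_summable[OF sums_half], of 0])
    (auto simp: bit_wave_bounds divide_right_mono)

lemma continuous_schoenberg: "continuous_on UNIV (\<lambda>t. schoenberg t i)"
proof -
  have "uniform_limit UNIV (\<lambda>N t. \<Sum>n<N. bit_wave (3 ^ prod_encode (i, n) * t) / 2 ^ Suc n)
      (\<lambda>t. \<Sum>n. bit_wave (3 ^ prod_encode (i, n) * t) / 2 ^ Suc n) sequentially"
    by (rule Weierstrass_m_test[OF _ sums_summable[OF sums_half]])
      (auto simp: bit_wave_bounds divide_right_mono)
  then show ?thesis
    unfolding schoenberg_def
    by (rule uniform_limit_theorem[rotated])
      (auto intro!: always_eventually continuous_intros continuous_on_compose2[OF continuous_bit_wave])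
qed

lemma measurable_cantor_code:
  assumes [measurable]: "\<And>i. (\<lambda>x. Y x i) \<in> borel_measurable M"
  shows "(\<lambda>x. cantor_code (Y x)) \<in> borel_measurable M"
  unfolding cantor_code_def by measurable

section \<open>Weak sequential compactness\<close>

lemma borel_probs_prob_space: "m \<in> borel_probs S \<Longrightarrow> prob_space m"
  by (simp add: borel_probs_def)

lemma borel_probs_sets: "m \<in> borel_probs S \<Longrightarrow> sets m = sets (restrict_space borel S)"
  by (simp add: borel_probs_def)

lemma borel_probs_space: "m \<in> borel_probs S \<Longrightarrow> space m = S"
  using sets_eq_imp_space_eq[OF borel_probs_sets] by (simp add: space_restrict_space)

lemma borel_probs_continuous_measurable:
  fixes g :: "'a::topological_space \<Rightarrow> 'b::topological_space"
  assumes "m \<in> borel_probs S" "continuous_on S g"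
  shows "g \<in> borel_measurable m"
  using borel_measurable_continuous_on_restrict[OF assms(2)]
    measurable_cong_sets[OF borel_probs_sets[OF assms(1)] refl] by blast

lemma continuous_integrable_borel_probs:
  fixes g :: "'a::t2_space \<Rightarrow> real"
  assumes "compact S" "m \<in> borel_probs S" "continuous_on S g"
  shows "integrable m g"
proof -
  interpret prob_space m by (rule borel_probs_prob_space[OF assms(2)])
  obtain B where "\<And>x. x \<in> S \<Longrightarrow> norm (g x) \<le> B"
    using compact_imp_bounded[OF compact_continuous_image[OF assms(3,1)]]
    unfolding bounded_iff by blast
  then show ?thesis
    by (intro integrable_const_bound[of _ B] borel_probs_continuous_measurable[OF assms(2,3)])
      (auto simp: borel_probs_space[OF assms(2)])
qed

text \<open>
  A retract-like presentation of \<open>S\<close> by the line. The section \<open>e\<close> need only be measurable, which is what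
  space-filling curves offer, while \<open>D\<close> is continuous and maps the whole line into \<open>S\<close>, so that weak
  limits on the line can be pushed to \<open>S\<close> with no control over where they are concentrated.
\<close>

definition parametrizable :: "'a::t2_space set \<Rightarrow> bool" where
  "parametrizable S \<longleftrightarrow> (\<exists>(D :: real \<Rightarrow> 'a) (e :: 'a \<Rightarrow> real).
     continuous_on UNIV D \<and> range D \<subseteq> S \<and> e \<in> borel_measurable (restrict_space borel S) \<and>
     (\<forall>x\<in>S. e x \<in> {0..1} \<and> D (e x) = x))"

lemma parametrizable_compact:
  assumes "parametrizable S"
  shows "compact S"
proof -
  obtain D :: "real \<Rightarrow> 'a" and e where D: "continuous_on UNIV D" "range D \<subseteq> S"
    "\<And>x. x \<in> S \<Longrightarrow> e x \<in> {0..1} \<and> D (e x) = x"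
    using assms unfolding parametrizable_def by blast
  have "S = D ` {0..1}" using D(2,3) by (force simp: image_iff)
  then show ?thesis
    using compact_continuous_image[OF continuous_on_subset[OF D(1)], of "{0..1}"] by auto
qed

text \<open>
  For continuous \<open>g\<close> on \<open>S\<close> the function \<open>g \<circ> D\<close> is bounded and continuous, and its integral against
  the image of \<open>m n\<close> under \<open>e\<close> equals \<open>\<integral>g dm n\<close> because \<open>D \<circ> e\<close> is the identity on \<open>S\<close>. The images
  live on \<open>[0, 1]\<close>, so they are tight.
\<close>

theorem weak_seq_compact_borel_probs:
  fixes S :: "'a::t2_space set"
  assumes S: "parametrizable S" and m: "\<And>n. m n \<in> borel_probs S"
  shows "\<exists>r p. strict_mono (r :: nat \<Rightarrow> nat) \<and> p \<in> borel_probs S \<and>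
    (\<forall>g::'a \<Rightarrow> real. continuous_on S g \<longrightarrow> (\<lambda>n. \<integral>x. g x \<partial>m (r n)) \<longlonglongrightarrow> (\<integral>x. g x \<partial>p))"
proof -
  obtain D :: "real \<Rightarrow> 'a" and e where D: "continuous_on UNIV D" "range D \<subseteq> S"
    and e: "e \<in> borel_measurable (restrict_space borel S)"
    and De: "\<And>x. x \<in> S \<Longrightarrow> e x \<in> {0..1} \<and> D (e x) = x"
    using S unfolding parametrizable_def by blast
  have prob: "prob_space (m n)" and sets: "sets (m n) = sets (restrict_space borel S)" for n
    using m[of n] by (auto simp: borel_probs_def)
  have space: "space (m n) = S" for n
    using sets_eq_imp_space_eq[OF sets[of n]] by (auto simp: space_restrict_space)
  have em: "e \<in> borel_measurable (m n)" for n
    using e sets[of n] by (simp cong: measurable_cong_sets)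
  have Dm: "D \<in> measurable borel (restrict_space borel S)"
    using D by (intro measurable_restrict_space2 borel_measurable_continuous_onI) auto
  define \<mu> where "\<mu> n = distr (m n) borel e" for n
  have rd: "real_distribution (\<mu> n)" for n
    unfolding \<mu>_def using prob_space.real_distribution_distr[OF prob em] .
  have tight: "tight \<mu>"
    unfolding tight_def
  proof (intro conjI allI impI rd)
    fix \<epsilon> :: real assume "0 < \<epsilon>"
    have "measure (\<mu> n) {-1<..1} = 1" for n
    proof -
      interpret prob_space "m n" by (rule prob)
      have "e -` {-1<..1} \<inter> space (m n) = space (m n)"
        using De by (fastforce simp: space)
      then show ?thesis unfolding \<mu>_def by (simp add: measure_distr[OF em] prob_space)
    qed
    then show "\<exists>a b. a < b \<and> (\<forall>n. 1 - \<epsilon> < measure (\<mu> n) {a<..b})"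
      using \<open>0 < \<epsilon>\<close> by (intro exI[of _ "-1"] exI[of _ 1]) auto
  qed
  obtain r N where r: "strict_mono (r :: nat \<Rightarrow> nat)" and N: "real_distribution N"
    and conv: "weak_conv_m (\<mu> \<circ> id \<circ> r) N"
    using tight_imp_convergent_subsubsequence[OF tight, of id] strict_mono_id by blast
  interpret N: real_distribution N by (rule N)
  have DN: "D \<in> measurable N (restrict_space borel S)"
    using Dm by (simp cong: measurable_cong_sets)
  define p where "p = distr N (restrict_space borel S) D"
  have "p \<in> borel_probs S"
    unfolding borel_probs_def p_def by (auto intro: N.prob_space_distr[OF DN])
  moreover have "(\<lambda>n. \<integral>x. g x \<partial>m (r n)) \<longlonglongrightarrow> (\<integral>x. g x \<partial>p)" if g: "continuous_on S g"
    for g :: "'a \<Rightarrow> real"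
  proof -
    have gm: "g \<in> borel_measurable (restrict_space borel S)"
      by (rule borel_measurable_continuous_on_restrict[OF g])
    have gD: "continuous_on UNIV (\<lambda>t. g (D t))"
      by (rule continuous_on_compose2[OF g D(1)]) (use D(2) in auto)
    obtain B where B: "\<And>x. x \<in> S \<Longrightarrow> norm (g x) \<le> B"
      using compact_imp_bounded[OF compact_continuous_image[OF g parametrizable_compact[OF S]]]
      unfolding bounded_iff by blast
    have "(\<lambda>n. \<integral>t. g (D t) \<partial>(\<mu> \<circ> id \<circ> r) n) \<longlonglongrightarrow> (\<integral>t. g (D t) \<partial>N)"
    proof (rule weak_conv_imp_integral_bdd_continuous_conv[OF _ N conv])
      show "isCont (\<lambda>t. g (D t)) x" for x
        using gD by (auto simp: continuous_on_eq_continuous_at)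
      show "norm (g (D x)) \<le> B" for x using B D(2) by auto
    qed (use rd in auto)
    moreover have "(\<integral>t. g (D t) \<partial>(\<mu> \<circ> id \<circ> r) n) = (\<integral>x. g x \<partial>m (r n))" for n
    proof -
      have "(\<integral>t. g (D t) \<partial>(\<mu> \<circ> id \<circ> r) n) = (\<integral>x. g (D (e x)) \<partial>m (r n))"
        unfolding \<mu>_def comp_def id_def
        by (intro integral_distr em borel_measurable_continuous_onI gD)
      also have "\<dots> = (\<integral>x. g x \<partial>m (r n))"
        by (intro Bochner_Integration.integral_cong) (auto simp: space De)
      finally show ?thesis .
    qed
    moreover have "(\<integral>t. g (D t) \<partial>N) = (\<integral>x. g x \<partial>p)"
      unfolding p_def by (rule integral_distr[OF DN gm, symmetric])
    ultimately show ?thesis by simp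
  qed
  ultimately show ?thesis using r by blast
qed

section \<open>A theorem of the alternative for moment inequalities\<close>

text \<open>
  The mixture of \<open>m\<close> with a point mass is the law of a random choice between \<open>z\<close> and a sample
  of \<open>m\<close>, made by an independent biased coin.
\<close>

lemma borel_probs_dirac_mixture:
  assumes S: "compact S" and m: "m \<in> borel_probs S" and z: "z \<in> S" and t: "0 \<le> t" "t \<le> 1"
  shows "\<exists>m'\<in>borel_probs S. \<forall>g::'a::t2_space \<Rightarrow> real. continuous_on S g \<longrightarrow>
    (\<integral>x. g x \<partial>m') = t * g z + (1 - t) * (\<integral>x. g x \<partial>m)"
proof -
  interpret m: prob_space m using m by (simp add: borel_probs_def)
  have sets: "sets m = sets (restrict_space borel S)" using m by (simp add: borel_probs_def)
  then have space: "space m = S" by (auto dest: sets_eq_imp_space_eq simp: space_restrict_space)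
  interpret P: pair_prob_space "measure_pmf (bernoulli_pmf t)" m ..
  let ?P = "measure_pmf (bernoulli_pmf t) \<Otimes>\<^sub>M m"
  define pick where "pick = (\<lambda>(b, w). if b then z else w)"
  have [measurable]: "pick \<in> measurable ?P m"
    unfolding pick_def using z by (simp add: space)
  have pick: "pick \<in> measurable ?P (restrict_space borel S)"
    using measurable_cong_sets[OF refl sets] \<open>pick \<in> measurable ?P m\<close> by blast
  define m' where "m' = distr ?P (restrict_space borel S) pick"
  have "m' \<in> borel_probs S"
    unfolding m'_def borel_probs_def by (auto intro: P.P.prob_space_distr[OF pick])
  moreover have "(\<integral>x. g x \<partial>m') = t * g z + (1 - t) * (\<integral>x. g x \<partial>m)"
    if g: "continuous_on S g" for g :: "'a \<Rightarrow> real"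
  proof -
    have gm: "g \<in> borel_measurable (restrict_space borel S)"
      by (rule borel_measurable_continuous_on_restrict[OF g])
    then have [measurable]: "g \<in> borel_measurable m"
      using sets by (simp cong: measurable_cong_sets)
    obtain B where B: "\<And>x. x \<in> S \<Longrightarrow> norm (g x) \<le> B"
      using compact_imp_bounded[OF compact_continuous_image[OF g S]]
      unfolding bounded_iff by blast
    have int: "integrable ?P (case_prod (\<lambda>b w. g (pick (b, w))))"
    proof (rule P.P.integrable_const_bound[of _ B])
      show "AE x in ?P. norm (case x of (b, w) \<Rightarrow> g (pick (b, w))) \<le> B"
        by (intro AE_I2) (use B z in \<open>auto simp: space_pair_measure space pick_def\<close>)
    qed measurable
    have "(\<integral>x. g x \<partial>m') = (\<integral>y. g (pick y) \<partial>?P)"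
      unfolding m'_def by (rule integral_distr[OF pick gm])
    also have "\<dots> = (\<integral>y. (case y of (b, w) \<Rightarrow> g (pick (b, w))) \<partial>?P)" by simp
    also have "\<dots> = (\<integral>b. (\<integral>w. g (pick (b, w)) \<partial>m) \<partial>measure_pmf (bernoulli_pmf t))"
      by (rule P.integral_fst'[OF int, symmetric, simplified])
    also have "\<dots> = t * g z + (1 - t) * (\<integral>x. g x \<partial>m)"
      using t by (simp add: pick_def m.prob_space)
    finally show ?thesis .
  qed
  ultimately show ?thesis by blast
qed

text \<open>
  The squared positive part is differentiable, and its second-order Taylor remainder is at most that of
  the square.
\<close>

lemma pos_part_square_le:
  fixes u w t :: real
  assumes "0 \<le> t"
  shows "(max 0 (u + t * w))\<^sup>2 \<le> (max 0 u)\<^sup>2 + 2 * t * (w * max 0 u) + t\<^sup>2 * w\<^sup>2"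
proof (cases "0 \<le> u")
  case True
  then have "(max 0 u)\<^sup>2 + 2 * t * (w * max 0 u) + t\<^sup>2 * w\<^sup>2 = (u + t * w)\<^sup>2"
    by (simp add: power2_eq_square algebra_simps)
  then show ?thesis by (auto simp: max_def)
next
  case False
  show ?thesis
  proof (cases "0 \<le> u + t * w")
    case True
    then have "(u + t * w)\<^sup>2 \<le> (t * w)\<^sup>2" using False by (intro power_mono) auto
    then show ?thesis using True False by (simp add: power_mult_distrib)
  qed (use False in auto)
qed

text \<open>
  Let \<open>p\<close> minimise the total squared violation \<open>\<Psi> m = \<Sum>h. (max 0 (\<integral>h dm))\<^sup>2\<close>; a minimiser exists by
  compactness. If \<open>\<Psi> p > 0\<close>, the violations at \<open>p\<close> serve as multipliers: moving \<open>p\<close>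
  slightly towards a point mass at \<open>z\<close> cannot decrease \<open>\<Psi>\<close>, and the derivative in this direction
  being nonnegative says that \<open>\<Sum>h. c h * h z \<ge> \<Psi> p\<close>. This replaces a separation theorem in a space whose
  dimension depends on the number of constraints.
\<close>

lemma ville_alternative_finite:
  fixes S :: "'a::t2_space set" and H :: "('a \<Rightarrow> real) set"
  assumes S: "parametrizable S" "S \<noteq> {}" and H: "finite H" "\<And>h. h \<in> H \<Longrightarrow> continuous_on S h"
  shows "(\<exists>m\<in>borel_probs S. \<forall>h\<in>H. (\<integral>x. h x \<partial>m) \<le> 0) \<or>
    (\<exists>c D. 0 < D \<and> (\<forall>h\<in>H. 0 \<le> c h) \<and> (\<forall>z\<in>S. D \<le> (\<Sum>h\<in>H. c h * h z)))"
proof -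
  define \<Psi> where "\<Psi> m = (\<Sum>h\<in>H. (max 0 (\<integral>x. h x \<partial>m))\<^sup>2)" for m :: "'a measure"
  have \<Psi>0: "0 \<le> \<Psi> m" for m unfolding \<Psi>_def by (intro sum_nonneg) auto
  obtain s where s: "s \<in> S" using S(2) by blast
  have ne: "borel_probs S \<noteq> {}"
  proof -
    have "return (restrict_space borel S) s \<in> borel_probs S"
      unfolding borel_probs_def using s by (auto intro!: prob_space_return simp: space_restrict_space)
    then show ?thesis by blast
  qed
  define I where "I = (INF m\<in>borel_probs S. \<Psi> m)"
  have bdd: "bdd_below (\<Psi> ` borel_probs S)" using \<Psi>0 by (intro bdd_belowI2) auto
  have "\<exists>m\<in>borel_probs S. \<Psi> m < I + 1 / Suc n" for n
    using cINF_less_iff[OF ne bdd, of "I + 1 / Suc n"] unfolding I_def by simp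
  then obtain M where M: "\<And>n. M n \<in> borel_probs S" "\<And>n. \<Psi> (M n) < I + 1 / Suc n"
    by metis
  obtain r p where r: "strict_mono (r :: nat \<Rightarrow> nat)" and p: "p \<in> borel_probs S"
    and lim: "\<forall>g::'a \<Rightarrow> real. continuous_on S g \<longrightarrow> (\<lambda>n. \<integral>x. g x \<partial>M (r n)) \<longlonglongrightarrow> (\<integral>x. g x \<partial>p)"
    using weak_seq_compact_borel_probs[OF S(1), of M, OF M(1)] by (elim exE conjE) (rule that)
  have "(\<lambda>n. \<Psi> (M (r n))) \<longlonglongrightarrow> \<Psi> p"
    unfolding \<Psi>_def by (intro tendsto_intros lim[rule_format] H(2))
  moreover have "(\<lambda>n. I + 1 / Suc (r n)) \<longlonglongrightarrow> I + 0"
    using LIMSEQ_subseq_LIMSEQ[OF LIMSEQ_inverse_real_of_nat r]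
    by (intro tendsto_intros) (simp add: comp_def inverse_eq_divide)
  ultimately have "\<Psi> p \<le> I"
    using M(2) by (intro LIMSEQ_le[of "\<lambda>n. \<Psi> (M (r n))" _ "\<lambda>n. I + 1 / Suc (r n)"])
      (auto intro: less_imp_le)
  then have min: "\<Psi> p \<le> \<Psi> m" if "m \<in> borel_probs S" for m
    using cINF_lower[OF bdd that] unfolding I_def by linarith
  show ?thesis
  proof (cases "\<Psi> p = 0")
    case True
    then have "(max 0 (\<integral>x. h x \<partial>p))\<^sup>2 = 0" if "h \<in> H" for h
      using that H(1) unfolding \<Psi>_def by (subst (asm) sum_nonneg_eq_0_iff) auto
    then have "(\<integral>x. h x \<partial>p) \<le> 0" if "h \<in> H" for h
      using that max.cobounded2[of "\<integral>x. h x \<partial>p" 0] by fastforce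
    then show ?thesis using p by blast
  next
    case False
    \<comment> \<open>the multipliers are the violations themselves, half the gradient of the penalty at \<open>p\<close>\<close>
    define c where "c h = max 0 (\<integral>x. h x \<partial>p)" for h :: "'a \<Rightarrow> real"
    have "\<Psi> p \<le> (\<Sum>h\<in>H. c h * h z)" if z: "z \<in> S" for z
    proof -
      define w where "w h = h z - (\<integral>x. h x \<partial>p)" for h :: "'a \<Rightarrow> real"
      define A where "A = 2 * (\<Sum>h\<in>H. w h * c h)"
      define B where "B = (\<Sum>h\<in>H. (w h)\<^sup>2)"
      have B: "0 \<le> B" unfolding B_def by (intro sum_nonneg) auto
      have slope: "0 \<le> A + t * B" if t: "0 < t" "t \<le> 1" for t
      proof -
        obtain m' where m': "m' \<in> borel_probs S"
          and int: "\<forall>g::'a \<Rightarrow> real. continuous_on S g \<longrightarrow>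
            (\<integral>x. g x \<partial>m') = t * g z + (1 - t) * (\<integral>x. g x \<partial>p)"
          using borel_probs_dirac_mixture[OF parametrizable_compact[OF S(1)] p z, of t] t
          by (meson less_imp_le)
        have "\<Psi> m' \<le> (\<Sum>h\<in>H. (c h)\<^sup>2 + 2 * t * (w h * c h) + t\<^sup>2 * (w h)\<^sup>2)"
          unfolding \<Psi>_def c_def
        proof (rule sum_mono)
          fix h assume "h \<in> H"
          then have "(\<integral>x. h x \<partial>m') = (\<integral>x. h x \<partial>p) + t * w h"
            using int[rule_format, OF H(2)] by (simp add: w_def algebra_simps)
          then show "(max 0 (\<integral>x. h x \<partial>m'))\<^sup>2 \<le> (max 0 (\<integral>x. h x \<partial>p))\<^sup>2
              + 2 * t * (w h * max 0 (\<integral>x. h x \<partial>p)) + t\<^sup>2 * (w h)\<^sup>2"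
            using pos_part_square_le[of t] t by simp
        qed
        also have "\<dots> = \<Psi> p + t * (A + t * B)"
          unfolding \<Psi>_def c_def[symmetric] A_def B_def
          by (simp add: sum.distrib sum_distrib_left power2_eq_square algebra_simps)
        finally have "\<Psi> m' \<le> \<Psi> p + t * (A + t * B)" .
        then have "0 \<le> t * (A + t * B)" using min[OF m'] by linarith
        then show ?thesis using t by (simp add: zero_le_mult_iff)
      qed
      have "0 \<le> A"
      proof (rule ccontr)
        assume neg: "\<not> 0 \<le> A"
        \<comment> \<open>half the step at which the bound \<open>A + t * (B + 1)\<close> would vanish\<close>
        define t where "t = min 1 (- A / (2 * (B + 1)))"
        have t: "0 < t" "t \<le> 1" using neg B by (auto simp: t_def divide_neg_pos)
        have "t * (B + 1) \<le> - A / (2 * (B + 1)) * (B + 1)"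
          using B by (intro mult_right_mono) (auto simp: t_def)
        also have "\<dots> = - A / 2" using B by (simp add: field_simps)
        finally have "t * B \<le> - A / 2" using t by (simp add: algebra_simps)
        then show False using slope[OF t] neg by linarith
      qed
      moreover have "(\<Sum>h\<in>H. c h * h z) = \<Psi> p + A / 2"
      proof -
        have "c h * h z = (c h)\<^sup>2 + w h * c h" for h
          by (auto simp: c_def w_def max_def power2_eq_square algebra_simps)
        then show ?thesis unfolding \<Psi>_def c_def[symmetric] A_def by (simp add: sum.distrib)
      qed
      ultimately show ?thesis by simp
    qed
    moreover have "0 < \<Psi> p" using False \<Psi>0[of p] by simp
    moreover have "0 \<le> c h" for h by (simp add: c_def)
    ultimately show ?thesis by blast
  qed
qed

text \<open>
  If every finite subsystem is solvable, a weak limit of solutions of an exhausting sequence of finite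
  subsystems solves all the inequalities.
\<close>

theorem ville_alternative_countable:
  fixes S :: "'a::t2_space set" and H :: "('a \<Rightarrow> real) set"
  assumes S: "parametrizable S" "S \<noteq> {}" and H: "countable H" "\<And>h. h \<in> H \<Longrightarrow> continuous_on S h"
  shows "(\<exists>m\<in>borel_probs S. \<forall>h\<in>H. (\<integral>x. h x \<partial>m) \<le> 0) \<or>
    (\<exists>F c D. finite F \<and> F \<subseteq> H \<and> 0 < D \<and> (\<forall>h\<in>F. 0 \<le> c h) \<and> (\<forall>z\<in>S. D \<le> (\<Sum>h\<in>F. c h * h z)))"
proof (rule disjCI)
  assume no: "\<not> (\<exists>F c D. finite F \<and> F \<subseteq> H \<and> 0 < D \<and> (\<forall>h\<in>F. 0 \<le> c h) \<and>
    (\<forall>z\<in>S. D \<le> (\<Sum>h\<in>F. c h * h z)))"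
  have sol: "\<exists>m\<in>borel_probs S. \<forall>h\<in>F. (\<integral>x. h x \<partial>m) \<le> 0" if F: "finite F" "F \<subseteq> H" for F
  proof -
    have "\<And>h. h \<in> F \<Longrightarrow> continuous_on S h" using F H(2) by auto
    from ville_alternative_finite[OF S F(1) this] show ?thesis using no F by blast
  qed
  show "\<exists>m\<in>borel_probs S. \<forall>h\<in>H. (\<integral>x. h x \<partial>m) \<le> 0"
  proof (cases "H = {}")
    case True
    then show ?thesis using sol[of "{}"] by auto
  next
    case False
    define F where "F N = from_nat_into H ` {..N}" for N :: nat
    have "\<exists>m\<in>borel_probs S. \<forall>h\<in>F N. (\<integral>x. h x \<partial>m) \<le> 0" for N
      by (rule sol) (use from_nat_into[OF False] in \<open>auto simp: F_def\<close>)
    then obtain M where M: "\<And>N. M N \<in> borel_probs S"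
      "\<And>N h. h \<in> F N \<Longrightarrow> (\<integral>x. h x \<partial>M N) \<le> 0"
      by metis
    obtain r p where r: "strict_mono (r :: nat \<Rightarrow> nat)" and p: "p \<in> borel_probs S"
      and lim: "\<forall>g::'a \<Rightarrow> real. continuous_on S g \<longrightarrow> (\<lambda>n. \<integral>x. g x \<partial>M (r n)) \<longlonglongrightarrow> (\<integral>x. g x \<partial>p)"
      using weak_seq_compact_borel_probs[OF S(1), of M, OF M(1)] by (elim exE conjE) (rule that)
    have "(\<integral>x. h x \<partial>p) \<le> 0" if h: "h \<in> H" for h
    proof -
      obtain N where N: "h = from_nat_into H N"
        using from_nat_into_surj[OF H(1) h] by metis
      have "(\<integral>x. h x \<partial>M (r n)) \<le> 0" if "N \<le> n" for n
        using M(2)[of h "r n"] N that seq_suble[OF r, of n] by (auto simp: F_def)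
      then show ?thesis
        by (intro LIMSEQ_le_const2[OF lim[rule_format, OF H(2)[OF h]]]) blast
    qed
    then show ?thesis using p by blast
  qed
qed

section \<open>Ramp functions determine finite measures\<close>

lemma continuous_coordinate [continuous_intros]: "continuous_on A (\<lambda>x::nat \<Rightarrow> real. x i)"
  by (rule continuous_on_subset[OF continuous_on_product_coordinates]) simp

lemma continuous_fst_coordinate [continuous_intros]:
  "continuous_on A (\<lambda>z::(nat \<Rightarrow> real) \<times> (nat \<Rightarrow> real). fst z i)"
  by (rule continuous_on_compose2[OF continuous_coordinate[of UNIV]])
    (auto intro: continuous_on_fst continuous_on_id)

lemma continuous_snd_coordinate [continuous_intros]:
  "continuous_on A (\<lambda>z::(nat \<Rightarrow> real) \<times> (nat \<Rightarrow> real). snd z i)"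
  by (rule continuous_on_compose2[OF continuous_coordinate[of UNIV]])
    (auto intro: continuous_on_snd continuous_on_id)

lemma continuous_restrict:
  "continuous_on A (\<lambda>x::nat \<Rightarrow> real. restrict x I)"
proof (rule continuous_on_coordinatewise_then_product)
  show "continuous_on A (\<lambda>x::nat \<Rightarrow> real. restrict x I i)" for i
    by (cases "i \<in> I") (auto intro: continuous_intros)
qed

text \<open>
  A continuous stand-in for the indicator of the box \<open>{x. \<forall>i\<in>I. x i \<le> a i}\<close>, to which it converges as
  \<open>n\<close> grows and \<open>q\<close> decreases to \<open>a\<close> at the right speed.
\<close>

definition ramp_box :: "nat set \<Rightarrow> nat \<Rightarrow> (nat \<Rightarrow> real) \<Rightarrow> (nat \<Rightarrow> real) \<Rightarrow> real" where
  "ramp_box I n q x = (\<Prod>i\<in>I. max 0 (min 1 (real n * (q i - x i))))"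

lemma ramp_box_bounds: "0 \<le> ramp_box I n q x" "ramp_box I n q x \<le> 1"
  unfolding ramp_box_def by (auto intro!: prod_nonneg prod_le_1)

lemma ramp_box_restrict [simp]: "ramp_box I n q (restrict x I) = ramp_box I n q x"
  unfolding ramp_box_def by (intro prod.cong) auto

lemma measurable_ramp_box [measurable]:
  "ramp_box I n q \<in> borel_measurable (PiM I (\<lambda>_. borel))"
  unfolding ramp_box_def by measurable

lemma continuous_ramp_box: "continuous_on A (ramp_box I n q)"
  unfolding ramp_box_def by (intro continuous_intros)

lemma continuous_ramp_box_single: "continuous_on A (\<lambda>t. ramp_box {k} n q (\<lambda>_. t))"
  unfolding ramp_box_def by (intro continuous_intros)

text \<open>
  The lower bound on \<open>q\<close> puts the whole box on the plateau of value 1, and the upper bound makes \<open>q\<close>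
  drop below any coordinate that lies outside. The window between the two leaves room for rational
  thresholds.
\<close>

lemma ramp_box_tendsto:
  fixes a :: "nat \<Rightarrow> real"
  assumes "finite I"
    and q: "\<And>n i. i \<in> I \<Longrightarrow> a i + 1 / Suc n < q n i" "\<And>n i. i \<in> I \<Longrightarrow> q n i < a i + 2 / Suc n"
  shows "(\<lambda>n. ramp_box I (Suc n) (q n) x) \<longlonglongrightarrow> (if \<forall>i\<in>I. x i \<le> a i then 1 else 0)"
proof -
  have one: "(\<lambda>n. max 0 (min 1 (real (Suc n) * (q n i - x i)))) \<longlonglongrightarrow> (if x i \<le> a i then 1 else 0)"
    if i: "i \<in> I" for i
  proof (cases "x i \<le> a i")
    case True
    have "max 0 (min 1 (real (Suc n) * (q n i - x i))) = 1" for n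
    proof -
      have "1 / real (Suc n) \<le> q n i - x i" using q(1)[OF i, of n] True by linarith
      then have "1 \<le> real (Suc n) * (q n i - x i)" by (simp add: field_simps)
      then show ?thesis by simp
    qed
    then show ?thesis using True by simp
  next
    case False
    obtain N where N: "2 / (x i - a i) < real N" using reals_Archimedean2 by blast
    have "max 0 (min 1 (real (Suc n) * (q n i - x i))) = 0" if "N \<le> n" for n
    proof -
      have "2 / (x i - a i) < real (Suc n)" using N that by linarith
      then have "2 / real (Suc n) < x i - a i" using False by (simp add: field_simps)
      then have "q n i - x i \<le> 0" using q(2)[OF i, of n] by linarith
      then have "real (Suc n) * (q n i - x i) \<le> 0" by (simp add: mult_nonneg_nonpos)
      then show ?thesis by linarith
    qed
    then have "\<forall>\<^sub>F n in sequentially. max 0 (min 1 (real (Suc n) * (q n i - x i))) = 0"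
      unfolding eventually_sequentially by blast
    then show ?thesis using False by (simp add: tendsto_eventually)
  qed
  have "(\<lambda>n. ramp_box I (Suc n) (q n) x) \<longlonglongrightarrow> (\<Prod>i\<in>I. if x i \<le> a i then 1 else 0)"
    unfolding ramp_box_def by (intro tendsto_prod one)
  also have "(\<Prod>i\<in>I. if x i \<le> a i then 1 else 0) = (if \<forall>i\<in>I. x i \<le> a i then 1 else (0::real))"
    using assms(1) by (auto intro!: prod.neutral prod_zero)
  finally show ?thesis .
qed

lemma sets_PiM_borel_boxes:
  fixes I :: "'i set"
  assumes "finite I"
  shows "sets (PiM I (\<lambda>_. borel :: real measure)) =
    sigma_sets (PiE I (\<lambda>_. UNIV)) (range (\<lambda>a. {x \<in> PiE I (\<lambda>_. UNIV). \<forall>i\<in>I. x i \<le> a i}))"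
proof -
  define P where "P = {{f\<in>(\<Pi>\<^sub>E i\<in>I. (UNIV::real set)). \<forall>i\<in>j. f i \<in> A i} | A j.
    j \<in> {I} \<and> A \<in> Pi j (\<lambda>_. range atMost)}"
  have "\<exists>S\<subseteq>range atMost. countable S \<and> (UNIV::real set) = \<Union>S"
    by (rule exI[of _ "range (\<lambda>n::nat. {..real n})"]) (auto intro: real_arch_simple)
  then have "sets (\<Pi>\<^sub>M i\<in>I. sigma (UNIV::real set) (range atMost))
      = sets (sigma (\<Pi>\<^sub>E i\<in>I. (UNIV::real set)) P)"
    unfolding P_def using assms by (intro sets_PiM_sigma) auto
  also have "\<dots> = sigma_sets (PiE I (\<lambda>_. UNIV)) P"
    by (rule sets_measure_of) (auto simp: P_def)
  also have "P = range (\<lambda>a. {x \<in> PiE I (\<lambda>_. UNIV). \<forall>i\<in>I. x i \<le> a i})"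
  proof (rule set_eqI, rule iffI)
    fix B assume "B \<in> P"
    then obtain A where B: "B = {f\<in>(\<Pi>\<^sub>E i\<in>I. (UNIV::real set)). \<forall>i\<in>I. f i \<in> A i}"
      and A: "A \<in> I \<rightarrow> range atMost"
      unfolding P_def by blast
    from A have "\<forall>i\<in>I. \<exists>a. A i = {..a}" by auto
    then obtain a where "\<forall>i\<in>I. A i = {..a i}" by metis
    then have "B = {x \<in> PiE I (\<lambda>_. UNIV). \<forall>i\<in>I. x i \<le> a i}" unfolding B by auto
    then show "B \<in> range (\<lambda>a. {x \<in> PiE I (\<lambda>_. UNIV). \<forall>i\<in>I. x i \<le> a i})" by blast
  next
    fix B assume "B \<in> range (\<lambda>a. {x \<in> PiE I (\<lambda>_. UNIV :: real set). \<forall>i\<in>I. x i \<le> a i})"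
    then obtain a :: "'i \<Rightarrow> real"
      where B: "B = {x \<in> PiE I (\<lambda>_. UNIV). \<forall>i\<in>I. x i \<le> a i}" by blast
    show "B \<in> P"
      unfolding P_def B by (rule CollectI, rule exI[of _ "\<lambda>i. {..a i}"], rule exI[of _ I]) auto
  qed
  finally show ?thesis by (simp only: borel_eq_atMost)
qed

text \<open>
  Boxes form an intersection-stable generator, and their measures are limits of ramp integrals. Only
  rational thresholds are used, so a countable family of continuous functions decides
  equality of measures.
\<close>

proposition finite_measure_eqI_ramp_box:
  fixes M N :: "(nat \<Rightarrow> real) measure"
  assumes I: "finite I"
    and M: "finite_measure M" "sets M = sets (PiM I (\<lambda>_. borel))"
    and N: "finite_measure N" "sets N = sets (PiM I (\<lambda>_. borel))"
    and eq: "\<And>n q. q \<in> PiE I (\<lambda>_. \<rat>) \<Longrightarrow> (\<integral>x. ramp_box I n q x \<partial>M) = (\<integral>x. ramp_box I n q x \<partial>N)"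
  shows "M = N"
proof -
  define box where "box a = {x \<in> PiE I (\<lambda>_. UNIV). \<forall>i\<in>I. x i \<le> a i}" for a :: "nat \<Rightarrow> real"
  have sets: "sets (PiM I (\<lambda>_. borel)) = sigma_sets (PiE I (\<lambda>_. UNIV)) (range box)"
    using sets_PiM_borel_boxes[OF I] unfolding box_def .
  have box_sets: "box a \<in> sets (PiM I (\<lambda>_. borel))" for a unfolding sets by blast
  have lim: "(\<lambda>n. \<integral>x. ramp_box I (Suc n) (q n) x \<partial>L) \<longlonglongrightarrow> measure L (box a)"
    if L: "finite_measure L" "sets L = sets (PiM I (\<lambda>_. borel))"
      and q: "\<And>n i. i \<in> I \<Longrightarrow> a i + 1 / Suc n < q n i" "\<And>n i. i \<in> I \<Longrightarrow> q n i < a i + 2 / Suc n"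
    for L q a
  proof -
    interpret finite_measure L by (rule L)
    have sp: "space L = PiE I (\<lambda>_. UNIV)"
      using sets_eq_imp_space_eq[OF L(2)] by (simp add: space_PiM)
    have box: "box a \<in> sets L" using box_sets L(2) by simp
    have "(\<lambda>n. \<integral>x. ramp_box I (Suc n) (q n) x \<partial>L) \<longlonglongrightarrow> (\<integral>x. indicator (box a) x \<partial>L)"
    proof (rule integral_dominated_convergence[where w = "\<lambda>_. 1"])
      show "AE x in L. (\<lambda>n. ramp_box I (Suc n) (q n) x) \<longlonglongrightarrow> indicator (box a) x"
      proof (rule AE_I2)
        fix x assume "x \<in> space L"
        then have "indicator (box a) x = (if \<forall>i\<in>I. x i \<le> a i then 1 else (0::real))"
          by (auto simp: box_def sp indicator_def)
        then show "(\<lambda>n. ramp_box I (Suc n) (q n) x) \<longlonglongrightarrow> indicator (box a) x"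
          using ramp_box_tendsto[OF I q, where x = x] by simp
      qed
      show "ramp_box I (Suc n) (q n) \<in> borel_measurable L" for n
        using measurable_ramp_box L(2) by (simp cong: measurable_cong_sets)
    qed (use box in \<open>auto simp: ramp_box_bounds\<close>)
    then show ?thesis using box by simp
  qed
  have "measure M (box a) = measure N (box a)" for a
  proof -
    have "\<forall>p. \<exists>s. s \<in> \<rat> \<and> a (snd p) + 1 / Suc (fst p) < s \<and> s < a (snd p) + 2 / Suc (fst p)"
    proof
      fix p :: "nat \<times> nat"
      have "a (snd p) + 1 / Suc (fst p) < a (snd p) + 2 / Suc (fst p)"
        by (simp add: divide_strict_right_mono)
      from Rats_dense_in_real[OF this]
      show "\<exists>s. s \<in> \<rat> \<and> a (snd p) + 1 / Suc (fst p) < s \<and> s < a (snd p) + 2 / Suc (fst p)"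
        by blast
    qed
    from choice[OF this] obtain r' where r': "\<forall>p. r' p \<in> \<rat> \<and>
      a (snd p) + 1 / Suc (fst p) < r' p \<and> r' p < a (snd p) + 2 / Suc (fst p)" ..
    define r where "r n i = r' (n, i)" for n i
    have r: "r n i \<in> \<rat>" "a i + 1 / Suc n < r n i" "r n i < a i + 2 / Suc n" for n i
      using r'[rule_format, of "(n, i)"] by (auto simp: r_def)
    define q where "q n = restrict (r n) I" for n
    have qQ: "q n \<in> PiE I (\<lambda>_. \<rat>)" for n using r(1) by (auto simp: q_def)
    have "(\<lambda>n. \<integral>x. ramp_box I (Suc n) (q n) x \<partial>M) \<longlonglongrightarrow> measure M (box a)"
      by (rule lim[OF M]) (use r(2,3) in \<open>auto simp: q_def\<close>)
    then have "(\<lambda>n. \<integral>x. ramp_box I (Suc n) (q n) x \<partial>N) \<longlonglongrightarrow> measure M (box a)"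
      by (simp only: eq[OF qQ])
    moreover have "(\<lambda>n. \<integral>x. ramp_box I (Suc n) (q n) x \<partial>N) \<longlonglongrightarrow> measure N (box a)"
      by (rule lim[OF N]) (use r(2,3) in \<open>auto simp: q_def\<close>)
    ultimately show ?thesis by (rule LIMSEQ_unique)
  qed
  then have eq_box: "emeasure M (box a) = emeasure N (box a)" for a
    using M(1) N(1) by (simp add: finite_measure.emeasure_eq_measure)
  show ?thesis
  proof (rule measure_eqI_generator_eq)
    show "Int_stable (range box)"
    proof (rule Int_stableI_image)
      show "\<exists>c\<in>UNIV. box a \<inter> box b = box c" for a b
        by (rule bexI[of _ "\<lambda>i. min (a i) (b i)"]) (auto simp: box_def)
    qed
    show "range (\<lambda>n::nat. box (\<lambda>_. real n)) \<subseteq> range box" by blast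
    show "(\<Union>n::nat. box (\<lambda>_. real n)) = PiE I (\<lambda>_. UNIV)"
    proof (intro set_eqI iffI)
      fix x :: "nat \<Rightarrow> real" assume x: "x \<in> PiE I (\<lambda>_. UNIV)"
      obtain n :: nat where n: "(\<Sum>i\<in>I. \<bar>x i\<bar>) \<le> real n" using real_arch_simple by blast
      have "x i \<le> real n" if "i \<in> I" for i
        using member_le_sum[of i I "\<lambda>i. \<bar>x i\<bar>"] I that n by fastforce
      then show "x \<in> (\<Union>n::nat. box (\<lambda>_. real n))" using x by (auto simp: box_def)
    qed (auto simp: box_def)
    show "emeasure M (box (\<lambda>_. real n)) \<noteq> \<infinity>" for n :: nat
      using finite_measure.emeasure_finite[OF M(1)] by (simp add: top.not_eq_extremum less_top)
    show "range box \<subseteq> Pow (PiE I (\<lambda>_. UNIV))" unfolding box_def by blast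
    show "emeasure M X = emeasure N X" if "X \<in> range box" for X
      using that eq_box by blast
    show "sets M = sigma_sets (PiE I (\<lambda>_. UNIV)) (range box)"
      using M(2) sets by (rule trans)
    show "sets N = sigma_sets (PiE I (\<lambda>_. UNIV)) (range box)"
      using N(2) sets by (rule trans)
  qed
qed

section \<open>Path space and martingale measures\<close>

lemma l1_dist_nonneg: "0 \<le> l1_dist d x y"
  unfolding l1_dist_def by (intro sum_nonneg) auto

lemma l1_dist_commute: "l1_dist d x y = l1_dist d y x"
  unfolding l1_dist_def by (simp add: abs_minus_commute)

locale interval_box =
  fixes d :: nat and \<Omega> :: "nat \<Rightarrow> real set"
  assumes intervals: "\<forall>k\<in>{1..d}. \<exists>a b. a \<le> b \<and> \<Omega> k = {a..b}"
begin

(* Otherwise the simplifier turns {1..k} into {Suc 0..k}. *)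
declare One_nat_def [simp del]

abbreviation paths :: "(nat \<Rightarrow> real) set" where "paths \<equiv> omega_prod d \<Omega>"

text \<open>
  Coordinates \<open>1..d\<close> of Schoenberg's curve serve the first path and \<open>d + 1..2 * d\<close> the second,
  after affine rescaling.
\<close>

lemma parametrizable_paths_Times: "parametrizable (paths \<times> paths)"
proof -
  obtain lo hi where lohi: "\<And>k. k \<in> {1..d} \<Longrightarrow> lo k \<le> hi k \<and> \<Omega> k = {lo k..hi k}"
    using intervals by metis
  \<comment> \<open>one unit longer than the interval: digits recover numbers in \<open>[0, 1)\<close> only, so the right endpoint must be scaled to less than 1; the excess is cut off by \<open>min\<close>\<close>
  define w where "w i = hi i - lo i + 1" for i
  have w: "1 \<le> w i" if "i \<in> {1..d}" for i using lohi[OF that] by (simp add: w_def)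
  define X where "X s t = (\<lambda>i\<in>{1..d}. min (hi i) (lo i + w i * schoenberg t (s + i)))" for s t
  define D where "D t = (X 0 t, X d t)" for t
  define Y where "Y z j = (if j \<le> d then (fst z j - lo j) / w j
    else (snd z (j - d) - lo (j - d)) / w (j - d))" for z :: "(nat \<Rightarrow> real) \<times> (nat \<Rightarrow> real)" and j
  have X_in: "X s t \<in> paths" for s t
    unfolding X_def omega_prod_def
  proof (rule restrict_PiE_iff[THEN iffD2], rule ballI)
    fix i assume i: "i \<in> {1..d}"
    then show "min (hi i) (lo i + w i * schoenberg t (s + i)) \<in> \<Omega> i"
      using lohi[OF i] w[OF i] schoenberg_nonneg[of t "s + i"] by simp
  qed
  have cX: "continuous_on UNIV (X s)" for s
    unfolding X_def
  proof (rule continuous_on_coordinatewise_then_product)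
    show "continuous_on UNIV (\<lambda>t. (\<lambda>i\<in>{1..d}. min (hi i) (lo i + w i * schoenberg t (s + i))) i)" for i
      by (cases "i \<in> {1..d}") (auto intro!: continuous_intros continuous_schoenberg)
  qed
  have scaled: "min (hi i) (lo i + w i * ((x i - lo i) / w i)) = x i"
    "0 \<le> (x i - lo i) / w i" "(x i - lo i) / w i < 1"
    if "x \<in> paths" "i \<in> {1..d}" for x i
  proof -
    have "x i \<in> \<Omega> i" using that by (auto simp: omega_prod_def)
    then have "lo i \<le> x i" "x i \<le> hi i" using lohi[OF that(2)] by auto
    moreover have "0 < w i" using w[OF that(2)] by simp
    ultimately show "min (hi i) (lo i + w i * ((x i - lo i) / w i)) = x i"
      "0 \<le> (x i - lo i) / w i" "(x i - lo i) / w i < 1"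
      by (auto simp: w_def)
  qed
  have inv: "D (cantor_code (Y z)) = z" if z: "z \<in> paths \<times> paths" for z
  proof -
    have fz: "fst z \<in> paths" and sz: "snd z \<in> paths" using z by auto
    have "X 0 (cantor_code (Y z)) i = fst z i" for i
    proof (cases "i \<in> {1..d}")
      case True
      then have "Y z i = (fst z i - lo i) / w i" by (simp add: Y_def)
      then show ?thesis
        using True scaled[OF fz True] by (simp add: X_def schoenberg_cantor_code)
    next
      case False
      then show ?thesis using fz by (auto simp: X_def omega_prod_def PiE_def extensional_def)
    qed
    moreover have "X d (cantor_code (Y z)) i = snd z i" for i
    proof (cases "i \<in> {1..d}")
      case True
      then have "Y z (d + i) = (snd z i - lo i) / w i" by (simp add: Y_def)
      then show ?thesis
        using True scaled[OF sz True] by (simp add: X_def schoenberg_cantor_code)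
    next
      case False
      then show ?thesis using sz by (auto simp: X_def omega_prod_def PiE_def extensional_def)
    qed
    ultimately show ?thesis unfolding D_def by (cases z) (simp add: fun_eq_iff)
  qed
  have "(\<lambda>z. cantor_code (Y z)) \<in> borel_measurable (restrict_space borel (paths \<times> paths))"
  proof (intro measurable_cantor_code measurable_restrict_space1)
    have [measurable]: "(\<lambda>z::(nat \<Rightarrow> real) \<times> (nat \<Rightarrow> real). fst z j) \<in> borel_measurable borel"
      "(\<lambda>z::(nat \<Rightarrow> real) \<times> (nat \<Rightarrow> real). snd z j) \<in> borel_measurable borel" for j
      by (intro borel_measurable_continuous_onI continuous_on_compose2[OF continuous_coordinate[of UNIV]]
          continuous_on_fst continuous_on_snd continuous_on_id subset_UNIV)+
    show "(\<lambda>z. Y z i) \<in> borel_measurable borel" for i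
      unfolding Y_def by measurable
  qed
  moreover have "continuous_on UNIV D" unfolding D_def by (intro continuous_on_Pair cX)
  moreover have "range D \<subseteq> paths \<times> paths" using X_in by (auto simp: D_def)
  ultimately show ?thesis
    unfolding parametrizable_def using cantor_code_bounds inv by blast
qed

lemma paths_nonempty: "paths \<noteq> {}"
  using intervals by (force simp: omega_prod_def PiE_eq_empty_iff)

lemma compact_paths: "compact paths"
proof -
  have "snd ` (paths \<times> paths) = paths" using paths_nonempty by auto
  then show ?thesis
    using compact_continuous_image[OF continuous_on_snd[OF continuous_on_id]
        parametrizable_compact[OF parametrizable_paths_Times]] by simp
qed

lemma closed_omega_prod:
  assumes "k \<le> d"
  shows "closed (omega_prod k \<Omega>)"
proof -
  have "interval_box k \<Omega>" using assms intervals by unfold_locales auto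
  then show ?thesis by (rule compact_imp_closed[OF interval_box.compact_paths])
qed

lemma compact_interval: "k \<in> {1..d} \<Longrightarrow> compact (\<Omega> k)"
  using intervals by (metis compact_Icc)

lemma restrict_paths: "x \<in> paths \<Longrightarrow> k \<le> d \<Longrightarrow> restrict x {1..k} \<in> omega_prod k \<Omega>"
  unfolding omega_prod_def by (rule restrict_PiE_iff[THEN iffD2]) (simp add: PiE_iff)

lemma measurable_coordinate:
  "m \<in> borel_probs paths \<Longrightarrow> (\<lambda>x. x i) \<in> borel_measurable m"
  by (rule borel_probs_continuous_measurable[OF _ continuous_coordinate])

lemma measurable_restrict_coordinates:
  assumes "m \<in> borel_probs paths"
  shows "(\<lambda>x. restrict x I) \<in> measurable m (PiM I (\<lambda>_. borel))"
  by (intro measurable_restrict measurable_coordinate assms)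

lemma space_coord_algebra: "space (coord_algebra paths k) = paths"
  by (simp add: coord_algebra_def)

lemma sets_coord_algebra:
  "sets (coord_algebra paths k) =
    {(\<lambda>x. restrict x {1..k}) -` B \<inter> paths | B. B \<in> sets (PiM {1..k} (\<lambda>_. borel))}"
  unfolding coord_algebra_def by (rule sets_vimage_algebra2) (auto simp: space_PiM)

lemma finite_measure_subalgebra_coord_algebra:
  assumes "m \<in> borel_probs paths"
  shows "finite_measure_subalgebra m (coord_algebra paths k)"
proof -
  interpret prob_space m by (rule borel_probs_prob_space[OF assms])
  have "subalgebra m (coord_algebra paths k)"
    unfolding subalgebra_def sets_coord_algebra space_coord_algebra
    using measurable_sets[OF measurable_restrict_coordinates[OF assms]]
    by (auto simp: borel_probs_space[OF assms])
  then show ?thesis by unfold_locales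
qed

lemma measurable_coord_algebra_restrict:
  "(\<lambda>x. restrict x {1..k}) \<in> measurable (coord_algebra paths k) (PiM {1..k} (\<lambda>_. borel))"
  unfolding coord_algebra_def by (rule measurable_vimage_algebra1) (auto simp: space_PiM)

text \<open>
  The integrands \<open>\<alpha>\<^sub>k\<close> are continuous for the topology of \<open>nat \<Rightarrow> real\<close>, whereas the filtration is built
  from the product sigma-algebra on \<open>{1..k}\<close>; the inclusion of the latter space into
  \<open>nat \<Rightarrow> real\<close> is measurable because the remaining coordinates are constant.
\<close>

lemma measurable_coord_algebra_continuous:
  fixes c :: "(nat \<Rightarrow> real) \<Rightarrow> real"
  assumes k: "k \<le> d" and c: "continuous_on (omega_prod k \<Omega>) c"
  shows "(\<lambda>x. c (restrict x {1..k})) \<in> borel_measurable (coord_algebra paths k)"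
proof -
  have inclusion: "(\<lambda>x. x) \<in> measurable (PiM {1..k} (\<lambda>_. borel)) (borel :: (nat \<Rightarrow> real) measure)"
  proof (rule measurable_coordinatewise_then_product)
    fix i
    show "(\<lambda>x. x i) \<in> borel_measurable (PiM {1..k} (\<lambda>_. borel :: real measure))"
    proof (cases "i \<in> {1..k}")
      case True
      then show ?thesis by (rule measurable_component_singleton)
    next
      case False
      then have "x i = undefined" if "x \<in> space (PiM {1..k} (\<lambda>_. borel :: real measure))" for x
        using that by (auto simp: space_PiM PiE_def extensional_def)
      then show ?thesis
        by (subst measurable_cong[where g = "\<lambda>_. undefined"]) auto
    qed
  qed
  have "(\<lambda>x. indicator (omega_prod k \<Omega>) x *\<^sub>R c x) \<in> borel_measurable borel"
    by (rule borel_measurable_continuous_on_indicator[OF _ c])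
      (simp add: closed_omega_prod[OF k])
  from measurable_compose[OF measurable_compose[OF measurable_coord_algebra_restrict inclusion] this]
  have "(\<lambda>x. indicator (omega_prod k \<Omega>) (restrict x {1..k}) *\<^sub>R c (restrict x {1..k}))
    \<in> borel_measurable (coord_algebra paths k)" .
  then show ?thesis
    by (rule measurable_cong[THEN iffD1, rotated])
      (simp add: space_coord_algebra restrict_paths[OF _ k])
qed

lemma continuous_on_restrict_paths:
  assumes "k \<le> d" "continuous_on (omega_prod k \<Omega>) c"
  shows "continuous_on paths (\<lambda>x. c (restrict x {1..k}))"
  by (rule continuous_on_compose2[OF assms(2) continuous_restrict])
    (use restrict_paths assms(1) in blast)

lemma martingale_increment_orthogonal:
  assumes m: "m \<in> martingale_measures d \<Omega>" and k: "k \<in> {1..<d}"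
    and c: "continuous_on (omega_prod k \<Omega>) c"
  shows "(\<integral>x. c (restrict x {1..k}) * (x (Suc k) - x k) \<partial>m) = 0"
proof -
  let ?F = "coord_algebra paths k" and ?c = "\<lambda>x. c (restrict x {1..k})"
  have mb: "m \<in> borel_probs paths" using m by (simp add: martingale_measures_def)
  interpret finite_measure_subalgebra m ?F
    by (rule finite_measure_subalgebra_coord_algebra[OF mb])
  have cc: "continuous_on paths ?c" using continuous_on_restrict_paths[OF _ c] k by simp
  have cF: "?c \<in> borel_measurable ?F" using measurable_coord_algebra_continuous[OF _ c] k by simp
  have cm: "?c \<in> borel_measurable m" by (rule borel_probs_continuous_measurable[OF mb cc])
  have int: "integrable m (\<lambda>x. ?c x * x i)" for i
    by (intro continuous_integrable_borel_probs[OF compact_paths mb] continuous_intros cc)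
  have "(\<integral>x. ?c x * x (Suc k) \<partial>m) = (\<integral>x. ?c x * real_cond_exp m ?F (\<lambda>x. x (Suc k)) x \<partial>m)"
    by (rule real_cond_exp_intg(2)[OF int cF measurable_coordinate[OF mb], symmetric])
  also have "\<dots> = (\<integral>x. ?c x * x k \<partial>m)"
  proof (rule integral_cong_AE)
    have "AE x in m. real_cond_exp m ?F (\<lambda>x. x (Suc k)) x = x k"
      using m k by (simp add: martingale_measures_def)
    then show "AE x in m. ?c x * real_cond_exp m ?F (\<lambda>x. x (Suc k)) x = ?c x * x k"
      by eventually_elim simp
    show "(\<lambda>x. ?c x * real_cond_exp m ?F (\<lambda>x. x (Suc k)) x) \<in> borel_measurable m"
      using cm by (intro borel_measurable_times borel_measurable_cond_exp2)
    show "(\<lambda>x. ?c x * x k) \<in> borel_measurable m"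
      using cm measurable_coordinate[OF mb] by (intro borel_measurable_times)
  qed
  finally show ?thesis by (simp add: right_diff_distrib int)
qed

text \<open>
  After adding a constant \<open>C\<close> that makes them nonnegative, \<open>X\<^sub>k\<close> and \<open>X\<^sub>k\<^sub>+\<^sub>1\<close> become densities. The
  hypothesis says that the two weighted measures, projected to the first \<open>k\<close> coordinates, have the same
  ramp integrals; so they coincide, and this is the defining property of the conditional expectation.
\<close>

lemma martingale_from_ramp_boxes:
  assumes m: "m \<in> borel_probs paths" and k: "k \<in> {1..<d}"
    and orth: "\<And>n q. q \<in> PiE {1..k} (\<lambda>_. \<rat>) \<Longrightarrow>
      (\<integral>x. ramp_box {1..k} n q x * (x (Suc k) - x k) \<partial>m) = 0"
  shows "AE x in m. real_cond_exp m (coord_algebra paths k) (\<lambda>x. x (Suc k)) x = x k"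
proof -
  let ?F = "coord_algebra paths k" and ?P = "PiM {1..k} (\<lambda>_. borel :: real measure)"
  let ?R = "\<lambda>x::nat \<Rightarrow> real. restrict x {1..k}"
  interpret finite_measure_subalgebra m ?F
    by (rule finite_measure_subalgebra_coord_algebra[OF m])
  note X [measurable] = measurable_coordinate[OF m]
  note R [measurable] = measurable_restrict_coordinates[OF m]
  have int: "integrable m (\<lambda>x. x i)" for i
    by (intro continuous_integrable_borel_probs[OF compact_paths m] continuous_intros)
  have "\<exists>C. \<forall>x\<in>paths. \<bar>x i\<bar> \<le> C" for i
    using compact_imp_bounded[OF compact_continuous_image[OF continuous_coordinate compact_paths, of i]]
    unfolding bounded_iff by auto
  then obtain C1 C2 where C12: "\<forall>x\<in>paths. \<bar>x k\<bar> \<le> C1" "\<forall>x\<in>paths. \<bar>x (Suc k)\<bar> \<le> C2" by meson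
  define C where "C = max C1 C2"
  have nonneg: "AE x in m. 0 \<le> x i + C" if "i \<in> {k, Suc k}" for i
  proof (rule AE_I2)
    fix x assume "x \<in> space m"
    then have "\<bar>x i\<bar> \<le> C" using C12 that by (fastforce simp: borel_probs_space[OF m] C_def)
    then show "0 \<le> x i + C" by linarith
  qed
  define M where "M i = distr (density m (\<lambda>x. ennreal (x i + C))) ?P ?R" for i
  have M_int: "(\<integral>y. g y \<partial>M i) = (\<integral>x. g (?R x) * (x i + C) \<partial>m)"
    if g [measurable]: "g \<in> borel_measurable ?P" and i: "i \<in> {k, Suc k}" for g :: "(nat \<Rightarrow> real) \<Rightarrow> real" and i
  proof -
    have "(\<integral>y. g y \<partial>M i) = (\<integral>x. g (?R x) \<partial>density m (\<lambda>x. ennreal (x i + C)))"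
      unfolding M_def by (rule integral_distr) auto
    also have "\<dots> = (\<integral>x. (x i + C) *\<^sub>R g (?R x) \<partial>m)"
      by (rule integral_density) (auto intro: nonneg[OF i])
    finally show ?thesis by (simp add: mult.commute)
  qed
  have fin: "finite_measure (M i)" if i: "i \<in> {k, Suc k}" for i
  proof -
    have "(\<integral>\<^sup>+x. ennreal (x i + C) \<partial>m) = ennreal (\<integral>x. x i + C \<partial>m)"
      using nonneg[OF i] int by (intro nn_integral_eq_integral) auto
    then have "finite_measure (density m (\<lambda>x. ennreal (x i + C)))"
      by (intro finite_measureI) (simp add: emeasure_density cong: nn_integral_cong)
    then show ?thesis unfolding M_def by (rule finite_measure.finite_measure_distr) simp
  qed
  have "M (Suc k) = M k"
  proof (rule finite_measure_eqI_ramp_box)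
    fix n and q :: "nat \<Rightarrow> real" assume q: "q \<in> PiE {1..k} (\<lambda>_. \<rat>)"
    have rint: "integrable m (\<lambda>x. ramp_box {1..k} n q x * x i)" 
      "integrable m (\<lambda>x. ramp_box {1..k} n q x * C)" for i
      unfolding ramp_box_def
      by (intro continuous_integrable_borel_probs[OF compact_paths m] continuous_intros)+
    have "(\<integral>x. ramp_box {1..k} n q x * x (Suc k) \<partial>m) = (\<integral>x. ramp_box {1..k} n q x * x k \<partial>m)"
      using orth[OF q, of n] by (simp add: right_diff_distrib rint)
    then show "(\<integral>y. ramp_box {1..k} n q y \<partial>M (Suc k)) = (\<integral>y. ramp_box {1..k} n q y \<partial>M k)"
      by (simp add: M_int measurable_ramp_box distrib_left
          Bochner_Integration.integral_add[OF rint(1) rint(2)])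
  qed (auto simp: fin, auto simp: M_def)
  then have eq: "(\<integral>x. g (?R x) * (x (Suc k) + C) \<partial>m) = (\<integral>x. g (?R x) * (x k + C) \<partial>m)"
    if "g \<in> borel_measurable ?P" for g :: "(nat \<Rightarrow> real) \<Rightarrow> real"
    using M_int[OF that, of "Suc k"] M_int[OF that, of k] by simp
  show ?thesis
  proof (rule real_cond_exp_charact)
    fix A assume "A \<in> sets ?F"
    then obtain B where B: "B \<in> sets ?P" and A: "A = ?R -` B \<inter> paths"
      unfolding sets_coord_algebra by blast
    have Am: "A \<in> sets m" using \<open>A \<in> sets ?F\<close> subalg by (auto simp: subalgebra_def)
    have ind: "indicator A x = (indicator B (?R x) :: real)" if "x \<in> space m" for x
      using that by (auto simp: A borel_probs_space[OF m] indicator_def)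
    have iA: "integrable m (\<lambda>x. indicator A x * x i)" "integrable m (\<lambda>x. indicator A x * C)" for i
      using integrable_mult_indicator[OF Am int[of i]] integrable_mult_indicator[OF Am, of "\<lambda>_. C"]
      by simp_all
    have ind_int: "(\<integral>x. indicator A x * (x i + C) \<partial>m) = (\<integral>x. indicator B (?R x) * (x i + C) \<partial>m)" for i
      by (intro Bochner_Integration.integral_cong) (auto simp: ind)
    have "(\<integral>x. indicator A x * (x (Suc k) + C) \<partial>m) = (\<integral>x. indicator A x * (x k + C) \<partial>m)"
      unfolding ind_int by (rule eq) (use B in simp)
    then show "(\<integral>x\<in>A. x (Suc k) \<partial>m) = (\<integral>x\<in>A. x k \<partial>m)"
      unfolding set_lebesgue_integral_def
      by (simp add: distrib_left Bochner_Integration.integral_add[OF iA(1) iA(2)])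
  next
    have "(\<lambda>x. ?R x k) \<in> borel_measurable ?F"
      by (rule measurable_compose[OF measurable_coord_algebra_restrict measurable_component_singleton])
        (use k in simp)
    then show "(\<lambda>x. x k) \<in> borel_measurable ?F" using k by simp
  qed (rule int)+
qed

section \<open>Weak duality\<close>

lemma integral_marginal:
  fixes b :: "real \<Rightarrow> real"
  assumes p: "p \<in> with_marginals d \<Omega> \<nu>" and k: "k \<in> {1..d}" and b: "continuous_on (\<Omega> k) b"
  shows "integrable p (\<lambda>x. b (x k))" "(\<integral>x. b (x k) \<partial>p) = (\<integral>t. b t \<partial>\<nu> k)"
proof -
  have pb: "p \<in> borel_probs paths" using p by (simp add: with_marginals_def)
  have \<nu>: "distr p (restrict_space borel (\<Omega> k)) (\<lambda>x. x k) = \<nu> k"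
    using p k by (simp add: with_marginals_def)
  have in_k: "x k \<in> \<Omega> k" if "x \<in> paths" for x using that k by (auto simp: omega_prod_def)
  have X: "(\<lambda>x. x k) \<in> measurable p (restrict_space borel (\<Omega> k))"
    using measurable_coordinate[OF pb] in_k
    by (intro measurable_restrict_space2) (auto simp: borel_probs_space[OF pb])
  have "continuous_on paths (\<lambda>x. b (x k))"
    by (rule continuous_on_compose2[OF b continuous_coordinate]) (use in_k in auto)
  then show "integrable p (\<lambda>x. b (x k))"
    by (rule continuous_integrable_borel_probs[OF compact_paths pb])
  show "(\<integral>x. b (x k) \<partial>p) = (\<integral>t. b t \<partial>\<nu> k)"
    unfolding \<nu>[symmetric]
    by (rule integral_distr[OF X borel_measurable_continuous_on_restrict[OF b], symmetric])
qed

lemma measurable_l1_dist: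
  assumes "p \<in> borel_probs paths" "p' \<in> borel_probs paths"
  shows "(\<lambda>z. l1_dist d (fst z) (snd z)) \<in> borel_measurable (p \<Otimes>\<^sub>M p')"
proof -
  have [measurable]: "(\<lambda>z. fst z i) \<in> borel_measurable (p \<Otimes>\<^sub>M p')"
    "(\<lambda>z. snd z i) \<in> borel_measurable (p \<Otimes>\<^sub>M p')" for i
    by (rule measurable_compose[OF measurable_fst measurable_coordinate[OF assms(1)]])
      (rule measurable_compose[OF measurable_snd measurable_coordinate[OF assms(2)]])
  show ?thesis unfolding l1_dist_def by measurable
qed

text \<open>
  Neither the distance to the set of measures with given marginals nor the Wasserstein distance need be
  known to be attained; an error \<open>\<delta>\<close> pays for both infima.
\<close>

lemma martingale_ball_near_coupling:
  assumes p: "p \<in> martingale_ball d \<Omega> \<nu> \<epsilon>" and "0 \<le> \<epsilon>" "0 < \<delta>"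
  obtains p' m where "p' \<in> with_marginals d \<Omega> \<nu>" "m \<in> couplings p p'"
    "integrable m (\<lambda>z. l1_dist d (fst z) (snd z))"
    "(\<integral>z. l1_dist d (fst z) (snd z) \<partial>m) \<le> \<epsilon> + \<delta>"
proof -
  have "ennreal \<epsilon> < ennreal (\<epsilon> + \<delta>)" using assms(2,3) by (simp add: ennreal_less_iff)
  then have "dist_to_marginals d \<Omega> \<nu> p < ennreal (\<epsilon> + \<delta>)"
    using p by (auto simp: martingale_ball_def intro: order.strict_trans1)
  then obtain p' where p': "p' \<in> with_marginals d \<Omega> \<nu>" "wasserstein d p p' < ennreal (\<epsilon> + \<delta>)"
    unfolding dist_to_marginals_def INF_less_iff by blast
  then obtain m where m: "m \<in> couplings p p'"
    "(\<integral>\<^sup>+ z. ennreal (l1_dist d (fst z) (snd z)) \<partial>m) < ennreal (\<epsilon> + \<delta>)"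
    unfolding wasserstein_def INF_less_iff by blast
  have pb: "p \<in> borel_probs paths" "p' \<in> borel_probs paths"
    using p p' by (auto simp: martingale_ball_def martingale_measures_def with_marginals_def)
  have meas: "(\<lambda>z. l1_dist d (fst z) (snd z)) \<in> borel_measurable m"
    using measurable_l1_dist[OF pb] m(1) measurable_cong_sets[of m "p \<Otimes>\<^sub>M p'" borel borel]
    by (auto simp: couplings_def)
  have int: "integrable m (\<lambda>z. l1_dist d (fst z) (snd z))"
    by (rule integrableI_nonneg[OF meas])
      (use m(2) l1_dist_nonneg in \<open>auto intro: order.strict_trans\<close>)
  have "ennreal (\<integral>z. l1_dist d (fst z) (snd z) \<partial>m) \<le> ennreal (\<epsilon> + \<delta>)"
    using m(2) nn_integral_eq_integral[OF int] l1_dist_nonneg by simp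
  then have "(\<integral>z. l1_dist d (fst z) (snd z) \<partial>m) \<le> \<epsilon> + \<delta>"
    by (rule ennreal_le_iff[THEN iffD1, rotated]) (use assms(2,3) in simp)
  from that[OF p'(1) m(1) int this] show thesis .
qed

text \<open>
  Integrate the dual inequality against the coupling of cost at most \<open>\<epsilon> + \<delta>\<close>: the martingale
  integral vanishes, the \<open>\<beta>\<close> terms integrate to the price of the static position, and \<open>\<delta>\<close> tends to 0.
\<close>

theorem weak_duality:
  assumes f: "continuous_on paths f" and \<epsilon>: "0 \<le> \<epsilon>"
    and dual: "(\<gamma>, \<alpha>, \<beta>) \<in> dual_feasible d \<Omega> f" and p: "p \<in> martingale_ball d \<Omega> \<nu> \<epsilon>"
  shows "(\<integral>x. f x \<partial>p) \<le> \<gamma> * \<epsilon> + (\<Sum>k=1..d. \<integral>t. \<beta> k t \<partial>\<nu> k)"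
proof -
  have \<gamma>: "0 \<le> \<gamma>" and \<alpha>: "\<And>k. k \<in> {1..<d} \<Longrightarrow> continuous_on (omega_prod k \<Omega>) (\<alpha> k)"
    and \<beta>: "\<And>k. k \<in> {1..d} \<Longrightarrow> continuous_on (\<Omega> k) (\<beta> k)"
    and le: "\<And>x x'. x \<in> paths \<Longrightarrow> x' \<in> paths \<Longrightarrow>
      f x' + (\<Sum>k\<in>{1..<d}. \<alpha> k (restrict x' {1..k}) * (x' (Suc k) - x' k))
        - \<gamma> * l1_dist d x x' - (\<Sum>k=1..d. \<beta> k (x k)) \<le> 0"
    using dual unfolding dual_feasible_def by auto
  have pm: "p \<in> martingale_measures d \<Omega>" and pb: "p \<in> borel_probs paths"
    using p by (auto simp: martingale_ball_def martingale_measures_def)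
  define A where "A x = (\<Sum>k\<in>{1..<d}. \<alpha> k (restrict x {1..k}) * (x (Suc k) - x k))" for x :: "nat \<Rightarrow> real"
  define B where "B x = (\<Sum>k=1..d. \<beta> k (x k))" for x :: "nat \<Rightarrow> real"
  have fint: "integrable p f" by (rule continuous_integrable_borel_probs[OF compact_paths pb f])
  have Aint_k: "integrable p (\<lambda>x. \<alpha> k (restrict x {1..k}) * (x (Suc k) - x k))" if "k \<in> {1..<d}" for k
    using continuous_on_restrict_paths[OF _ \<alpha>[OF that]] that
    by (intro continuous_integrable_borel_probs[OF compact_paths pb] continuous_intros) auto
  have Aint: "integrable p A" unfolding A_def by (rule Bochner_Integration.integrable_sum[OF Aint_k])
  have A0: "(\<integral>x. A x \<partial>p) = 0"
    unfolding A_def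
    by (subst Bochner_Integration.integral_sum[OF Aint_k])
      (auto intro!: sum.neutral martingale_increment_orthogonal[OF pm] \<alpha>)
  have bound: "(\<integral>x. f x \<partial>p) \<le> \<gamma> * (\<epsilon> + \<delta>) + (\<Sum>k=1..d. \<integral>t. \<beta> k t \<partial>\<nu> k)" if \<delta>: "0 < \<delta>" for \<delta>
  proof -
    obtain p' m where p': "p' \<in> with_marginals d \<Omega> \<nu>" and m: "m \<in> couplings p p'"
      and lint: "integrable m (\<lambda>z. l1_dist d (fst z) (snd z))"
      and cost: "(\<integral>z. l1_dist d (fst z) (snd z) \<partial>m) \<le> \<epsilon> + \<delta>"
      by (rule martingale_ball_near_coupling[OF p \<epsilon> \<delta>])
    have p'b: "p' \<in> borel_probs paths" using p' by (simp add: with_marginals_def)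
    have sets: "sets m = sets (p \<Otimes>\<^sub>M p')" and m1: "distr m p fst = p" and m2: "distr m p' snd = p'"
      using m by (auto simp: couplings_def)
    have fst_m: "fst \<in> measurable m p" and snd_m: "snd \<in> measurable m p'"
      using measurable_cong_sets[OF sets refl] measurable_fst measurable_snd by blast+
    have space: "space m = paths \<times> paths"
      using sets_eq_imp_space_eq[OF sets]
      by (simp add: space_pair_measure borel_probs_space[OF pb] borel_probs_space[OF p'b])
    have left: "integrable m (\<lambda>z. g (fst z))" "(\<integral>z. g (fst z) \<partial>m) = (\<integral>x. g x \<partial>p)"
      if g: "integrable p g" for g :: "(nat \<Rightarrow> real) \<Rightarrow> real"
    proof -
      show "integrable m (\<lambda>z. g (fst z))"
        using integrable_distr[OF fst_m, of g] g by (simp add: m1)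
      show "(\<integral>z. g (fst z) \<partial>m) = (\<integral>x. g x \<partial>p)"
        using integral_distr[OF fst_m borel_measurable_integrable[OF g]] by (simp add: m1)
    qed
    have right: "integrable m (\<lambda>z. g (snd z))" "(\<integral>z. g (snd z) \<partial>m) = (\<integral>x. g x \<partial>p')"
      if g: "integrable p' g" for g :: "(nat \<Rightarrow> real) \<Rightarrow> real"
    proof -
      show "integrable m (\<lambda>z. g (snd z))"
        using integrable_distr[OF snd_m, of g] g by (simp add: m2)
      show "(\<integral>z. g (snd z) \<partial>m) = (\<integral>x. g x \<partial>p')"
        using integral_distr[OF snd_m borel_measurable_integrable[OF g]] by (simp add: m2)
    qed
    have Bint: "integrable p' B"
      unfolding B_def by (rule Bochner_Integration.integrable_sum[OF integral_marginal(1)[OF p' _ \<beta>]])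
    have B: "(\<integral>x. B x \<partial>p') = (\<Sum>k=1..d. \<integral>t. \<beta> k t \<partial>\<nu> k)"
      unfolding B_def
      by (subst Bochner_Integration.integral_sum[OF integral_marginal(1)[OF p' _ \<beta>]])
        (auto intro!: sum.cong integral_marginal(2)[OF p'] \<beta>)
    have "(\<integral>z. f (fst z) + A (fst z) - \<gamma> * l1_dist d (fst z) (snd z) - B (snd z) \<partial>m)
        \<le> (\<integral>z. 0 \<partial>m)"
    proof (rule integral_mono)
      show "integrable m (\<lambda>z. f (fst z) + A (fst z) - \<gamma> * l1_dist d (fst z) (snd z) - B (snd z))"
        by (intro Bochner_Integration.integrable_diff Bochner_Integration.integrable_add
            integrable_mult_right left(1) right(1) fint Aint Bint lint)
      show "f (fst z) + A (fst z) - \<gamma> * l1_dist d (fst z) (snd z) - B (snd z) \<le> 0"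
        if "z \<in> space m" for z
        using le[of "snd z" "fst z"] that by (auto simp: space A_def B_def l1_dist_commute)
    qed simp
    moreover have "(\<integral>z. f (fst z) + A (fst z) - \<gamma> * l1_dist d (fst z) (snd z) - B (snd z) \<partial>m)
        = (\<integral>x. f x \<partial>p) - \<gamma> * (\<integral>z. l1_dist d (fst z) (snd z) \<partial>m) - (\<Sum>k=1..d. \<integral>t. \<beta> k t \<partial>\<nu> k)"
      using left[OF fint] left[OF Aint] right[OF Bint] lint by (simp add: A0 B)
    moreover have "\<gamma> * (\<integral>z. l1_dist d (fst z) (snd z) \<partial>m) \<le> \<gamma> * (\<epsilon> + \<delta>)"
      using cost \<gamma> by (rule mult_left_mono)
    ultimately show ?thesis by simp
  qed
  show ?thesis
  proof (rule field_le_epsilon)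
    fix e :: real assume e: "0 < e"
    have "\<gamma> * (e / (\<gamma> + 1)) \<le> e" using \<gamma> e by (simp add: field_simps)
    then show "(\<integral>x. f x \<partial>p) \<le> \<gamma> * \<epsilon> + (\<Sum>k=1..d. \<integral>t. \<beta> k t \<partial>\<nu> k) + e"
      using bound[of "e / (\<gamma> + 1)"] \<gamma> e by (simp add: distrib_left)
  qed
qed

end

section \<open>The cone of affordable_surplusd claims\<close>

locale robust_martingale_transport = interval_box +
  fixes f :: "(nat \<Rightarrow> real) \<Rightarrow> real" and \<nu> :: "nat \<Rightarrow> real measure" and \<epsilon> :: real
  assumes d_pos: "1 \<le> d"
    and continuous_f: "continuous_on paths f"
    and marginals: "\<And>k. k \<in> {1..d} \<Longrightarrow> \<nu> k \<in> borel_probs (\<Omega> k)"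
    and eps_pos: "0 < \<epsilon>"
begin

text \<open>
  Read the dual as hedging: \<open>h\<close> is the surplus left after delivering \<open>a\<close> copies of \<open>f\<close> out of static
  positions \<open>\<beta>\<close>, dynamic positions \<open>- \<alpha>\<close> and \<open>\<gamma>\<close> units of transport cost, and the last conjunct says
  that selling each copy of \<open>f\<close> at price \<open>c\<close> pays for these positions.
\<close>

definition surplus_of ::
    "real \<Rightarrow> ((nat \<Rightarrow> real) \<times> (nat \<Rightarrow> real) \<Rightarrow> real) \<Rightarrow> real \<Rightarrow> real \<Rightarrow>
     (nat \<Rightarrow> (nat \<Rightarrow> real) \<Rightarrow> real) \<Rightarrow> (nat \<Rightarrow> real \<Rightarrow> real) \<Rightarrow> bool" where
  "surplus_of c h a \<gamma> \<alpha> \<beta> \<longleftrightarrow> 0 \<le> a \<and> 0 \<le> \<gamma> \<and>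
     (\<forall>k\<in>{1..<d}. continuous_on (omega_prod k \<Omega>) (\<alpha> k)) \<and>
     (\<forall>k\<in>{1..d}. continuous_on (\<Omega> k) (\<beta> k)) \<and>
     (\<forall>x\<in>paths. \<forall>x'\<in>paths. h (x, x') = \<gamma> * l1_dist d x x' + (\<Sum>k=1..d. \<beta> k (x k)) - a * f x'
        - (\<Sum>k\<in>{1..<d}. \<alpha> k (restrict x' {1..k}) * (x' (Suc k) - x' k))) \<and>
     \<gamma> * \<epsilon> + (\<Sum>k=1..d. \<integral>t. \<beta> k t \<partial>\<nu> k) \<le> a * c"

definition affordable_surplus :: "real \<Rightarrow> ((nat \<Rightarrow> real) \<times> (nat \<Rightarrow> real) \<Rightarrow> real) \<Rightarrow> bool" where
  "affordable_surplus c h \<longleftrightarrow> (\<exists>a \<gamma> \<alpha> \<beta>. surplus_of c h a \<gamma> \<alpha> \<beta>)"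

lemma surplus_ofD:
  assumes "surplus_of c h a \<gamma> \<alpha> \<beta>"
  shows "0 \<le> a" "0 \<le> \<gamma>"
    "\<And>k. k \<in> {1..<d} \<Longrightarrow> continuous_on (omega_prod k \<Omega>) (\<alpha> k)"
    "\<And>k. k \<in> {1..d} \<Longrightarrow> continuous_on (\<Omega> k) (\<beta> k)"
    "\<And>x x'. x \<in> paths \<Longrightarrow> x' \<in> paths \<Longrightarrow> h (x, x') = \<gamma> * l1_dist d x x' + (\<Sum>k=1..d. \<beta> k (x k))
      - a * f x' - (\<Sum>k\<in>{1..<d}. \<alpha> k (restrict x' {1..k}) * (x' (Suc k) - x' k))"
    "\<gamma> * \<epsilon> + (\<Sum>k=1..d. \<integral>t. \<beta> k t \<partial>\<nu> k) \<le> a * c"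
  using assms unfolding surplus_of_def by blast+

lemma integrable_marginal:
  "k \<in> {1..d} \<Longrightarrow> continuous_on (\<Omega> k) b \<Longrightarrow> integrable (\<nu> k) b" for b :: "real \<Rightarrow> real"
  by (rule continuous_integrable_borel_probs[OF compact_interval marginals])

text \<open>
  Affordable surpluses form a convex cone. This is why every combination that the theorem of the alternative
  may produce is again of this form.
\<close>

lemma affordable_surplus_scale_add:
  assumes h: "affordable_surplus c h" and h': "affordable_surplus c h'" and s: "0 \<le> s"
  shows "affordable_surplus c (\<lambda>z. s * h z + h' z)"
proof -
  obtain a \<gamma> \<alpha> \<beta> where "surplus_of c h a \<gamma> \<alpha> \<beta>" using h unfolding affordable_surplus_def by blast
  note 1 = surplus_ofD[OF this]
  obtain a' \<gamma>' \<alpha>' \<beta>' where "surplus_of c h' a' \<gamma>' \<alpha>' \<beta>'" using h' unfolding affordable_surplus_def by blast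
  note 2 = surplus_ofD[OF this]
  have "(\<Sum>k=1..d. \<integral>t. s * \<beta> k t + \<beta>' k t \<partial>\<nu> k)
      = (\<Sum>k=1..d. s * (\<integral>t. \<beta> k t \<partial>\<nu> k) + (\<integral>t. \<beta>' k t \<partial>\<nu> k))"
    by (intro sum.cong refl) (simp add: integrable_marginal 1(4) 2(4))
  then have cost: "(s * \<gamma> + \<gamma>') * \<epsilon> + (\<Sum>k=1..d. \<integral>t. s * \<beta> k t + \<beta>' k t \<partial>\<nu> k)
      = s * (\<gamma> * \<epsilon> + (\<Sum>k=1..d. \<integral>t. \<beta> k t \<partial>\<nu> k)) + (\<gamma>' * \<epsilon> + (\<Sum>k=1..d. \<integral>t. \<beta>' k t \<partial>\<nu> k))"
    by (simp add: sum.distrib sum_distrib_left algebra_simps)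
  show ?thesis
    unfolding affordable_surplus_def surplus_of_def
  proof (intro exI conjI ballI)
    show "0 \<le> s * a + a'" "0 \<le> s * \<gamma> + \<gamma>'" using s 1(1,2) 2(1,2) by auto
    show "continuous_on (omega_prod k \<Omega>) (\<lambda>x. s * \<alpha> k x + \<alpha>' k x)" if "k \<in> {1..<d}" for k
      by (intro continuous_intros 1(3) 2(3) that)
    show "continuous_on (\<Omega> k) (\<lambda>x. s * \<beta> k x + \<beta>' k x)" if "k \<in> {1..d}" for k
      by (intro continuous_intros 1(4) 2(4) that)
    show "s * h (x, x') + h' (x, x') = (s * \<gamma> + \<gamma>') * l1_dist d x x'
        + (\<Sum>k=1..d. s * \<beta> k (x k) + \<beta>' k (x k)) - (s * a + a') * f x'
        - (\<Sum>k\<in>{1..<d}. (s * \<alpha> k (restrict x' {1..k}) + \<alpha>' k (restrict x' {1..k})) * (x' (Suc k) - x' k))"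
      if "x \<in> paths" "x' \<in> paths" for x x'
    proof -
      have "(\<Sum>k\<in>{1..<d}. (s * \<alpha> k (restrict x' {1..k}) + \<alpha>' k (restrict x' {1..k})) * (x' (Suc k) - x' k))
          = s * (\<Sum>k\<in>{1..<d}. \<alpha> k (restrict x' {1..k}) * (x' (Suc k) - x' k))
            + (\<Sum>k\<in>{1..<d}. \<alpha>' k (restrict x' {1..k}) * (x' (Suc k) - x' k))"
        by (simp add: sum_distrib_left sum.distrib[symmetric] distrib_right mult.assoc)
      moreover have "(\<Sum>k=1..d. s * \<beta> k (x k) + \<beta>' k (x k))
          = s * (\<Sum>k=1..d. \<beta> k (x k)) + (\<Sum>k=1..d. \<beta>' k (x k))"
        by (simp add: sum_distrib_left sum.distrib)
      ultimately show ?thesis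
        unfolding 1(5)[OF that] 2(5)[OF that] by (simp add: algebra_simps)
    qed
    show "(s * \<gamma> + \<gamma>') * \<epsilon> + (\<Sum>k=1..d. \<integral>t. s * \<beta> k t + \<beta>' k t \<partial>\<nu> k) \<le> (s * a + a') * c"
      unfolding cost using mult_left_mono[OF 1(6) s] 2(6) by (simp add: algebra_simps)
  qed
qed

lemma affordable_surplus_zero: "affordable_surplus c (\<lambda>_. 0)"
  unfolding affordable_surplus_def surplus_of_def
  by (intro exI[of _ 0] exI[of _ "\<lambda>_ _. 0"]) simp

lemma affordable_surplus_sum:
  assumes "finite F" "\<And>h. h \<in> F \<Longrightarrow> affordable_surplus c h" "\<And>h. h \<in> F \<Longrightarrow> 0 \<le> w h"
  shows "affordable_surplus c (\<lambda>z. \<Sum>h\<in>F. w h * h z)"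
  using assms
proof (induction F rule: finite_induct)
  case (insert h F)
  then show ?case
    using affordable_surplus_scale_add[of c h "\<lambda>z. \<Sum>h\<in>F. w h * h z" "w h"] by simp
qed (simp add: affordable_surplus_zero)

lemma affordable_surplus_payoff: "affordable_surplus c (\<lambda>z. c - f (snd z))"
  unfolding affordable_surplus_def surplus_of_def
proof (intro exI conjI ballI)
  let ?\<beta> = "\<lambda>(k::nat) (t::real). if k = 1 then c else 0"
  have "(\<integral>t. ?\<beta> k t \<partial>\<nu> k) = (if k = 1 then c else 0)" if "k \<in> {1..d}" for k
    using prob_space.prob_space[OF borel_probs_prob_space[OF marginals[OF that]]] by simp
  then have "(\<Sum>k=1..d. \<integral>t. ?\<beta> k t \<partial>\<nu> k) = (\<Sum>k=1..d. if k = 1 then c else 0)"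
    by (rule sum.cong[OF refl])
  then show "0 * \<epsilon> + (\<Sum>k=1..d. \<integral>t. ?\<beta> k t \<partial>\<nu> k) \<le> 1 * c"
    using d_pos by simp
  show "c - f (snd (x, x')) = 0 * l1_dist d x x' + (\<Sum>k=1..d. ?\<beta> k (x k)) - 1 * f x'
      - (\<Sum>k\<in>{1..<d}. (\<lambda>_ _. 0) k (restrict x' {1..k}) * (x' (Suc k) - x' k))" for x x'
    using d_pos by simp
qed auto

lemma affordable_surplus_transport_cost: "affordable_surplus c (\<lambda>z. l1_dist d (fst z) (snd z) - \<epsilon>)"
  unfolding affordable_surplus_def surplus_of_def
proof (intro exI conjI ballI)
  let ?\<beta> = "\<lambda>(k::nat) (t::real). if k = 1 then - \<epsilon> else 0"
  have "(\<integral>t. ?\<beta> k t \<partial>\<nu> k) = (if k = 1 then - \<epsilon> else 0)" if "k \<in> {1..d}" for k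
    using prob_space.prob_space[OF borel_probs_prob_space[OF marginals[OF that]]] by simp
  then have "(\<Sum>k=1..d. \<integral>t. ?\<beta> k t \<partial>\<nu> k) = (\<Sum>k=1..d. if k = 1 then - \<epsilon> else 0)"
    by (rule sum.cong[OF refl])
  then show "1 * \<epsilon> + (\<Sum>k=1..d. \<integral>t. ?\<beta> k t \<partial>\<nu> k) \<le> 0 * c"
    using d_pos by simp
  show "l1_dist d (fst (x, x')) (snd (x, x')) - \<epsilon> = 1 * l1_dist d x x'
      + (\<Sum>k=1..d. ?\<beta> k (x k)) - 0 * f x'
      - (\<Sum>k\<in>{1..<d}. (\<lambda>_ _. 0) k (restrict x' {1..k}) * (x' (Suc k) - x' k))" for x x'
    using d_pos by simp
qed auto

text \<open>
  The factor \<open>s\<close> takes the values \<open>1\<close> and \<open>-1\<close>, which turns an equation into two inequalities.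
\<close>

definition martingale_test ::
    "real \<Rightarrow> nat \<Rightarrow> nat \<Rightarrow> (nat \<Rightarrow> real) \<Rightarrow> (nat \<Rightarrow> real) \<times> (nat \<Rightarrow> real) \<Rightarrow> real" where
  "martingale_test s k n q z = s * (ramp_box {1..k} n q (snd z) * (snd z (Suc k) - snd z k))"

definition marginal_test ::
    "real \<Rightarrow> nat \<Rightarrow> nat \<Rightarrow> (nat \<Rightarrow> real) \<Rightarrow> (nat \<Rightarrow> real) \<times> (nat \<Rightarrow> real) \<Rightarrow> real" where
  "marginal_test s k n q z =
     s * (ramp_box {k} n q (fst z) - (\<integral>t. ramp_box {k} n q (\<lambda>_. t) \<partial>\<nu> k))"

lemma affordable_surplus_martingale_test:
  assumes k: "k \<in> {1..<d}"
  shows "affordable_surplus c (martingale_test s k n q)"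
  unfolding affordable_surplus_def surplus_of_def
proof (intro exI conjI ballI)
  let ?\<alpha> = "\<lambda>j x. if j = k then - s * ramp_box {1..k} n q x else 0"
  show "continuous_on (omega_prod j \<Omega>) (?\<alpha> j)" for j
    by (cases "j = k") (auto intro!: continuous_on_minus continuous_on_mult_left continuous_ramp_box)
  show "martingale_test s k n q (x, x') = 0 * l1_dist d x x' + (\<Sum>j=1..d. (\<lambda>_ _. 0) j (x j)) - 0 * f x'
      - (\<Sum>j\<in>{1..<d}. ?\<alpha> j (restrict x' {1..j}) * (x' (Suc j) - x' j))" for x x'
  proof -
    have "(\<Sum>j\<in>{1..<d}. ?\<alpha> j (restrict x' {1..j}) * (x' (Suc j) - x' j))
        = (\<Sum>j\<in>{1..<d}. if j = k then - s * ramp_box {1..k} n q x' * (x' (Suc k) - x' k) else 0)"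
      by (intro sum.cong) auto
    then show ?thesis using k by (simp add: martingale_test_def)
  qed
qed auto

lemma affordable_surplus_marginal_test:
  assumes k: "k \<in> {1..d}"
  shows "affordable_surplus c (marginal_test s k n q)"
  unfolding affordable_surplus_def surplus_of_def
proof (intro exI conjI ballI)
  let ?I = "\<integral>t. ramp_box {k} n q (\<lambda>_. t) \<partial>\<nu> k"
  let ?\<beta> = "\<lambda>j t. if j = k then s * (ramp_box {k} n q (\<lambda>_. t) - ?I) else 0"
  show "continuous_on (\<Omega> j) (?\<beta> j)" for j
    by (cases "j = k") (auto intro!: continuous_intros continuous_ramp_box_single)
  have "(\<integral>t. ?\<beta> j t \<partial>\<nu> j) = 0" for j
  proof (cases "j = k")
    case True
    interpret prob_space "\<nu> k" by (rule borel_probs_prob_space[OF marginals[OF k]])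
    show ?thesis
      using True integrable_marginal[OF k continuous_ramp_box_single] by (simp add: prob_space)
  qed simp
  then show "0 * \<epsilon> + (\<Sum>j=1..d. \<integral>t. ?\<beta> j t \<partial>\<nu> j) \<le> 0 * c" by simp
  show "marginal_test s k n q (x, x') = 0 * l1_dist d x x' + (\<Sum>j=1..d. ?\<beta> j (x j)) - 0 * f x'
      - (\<Sum>j\<in>{1..<d}. (\<lambda>_ _. 0) j (restrict x' {1..j}) * (x' (Suc j) - x' j))" for x x'
  proof -
    have "(\<Sum>j=1..d. ?\<beta> j (x j)) = (\<Sum>j=1..d. if j = k then s * (ramp_box {k} n q (\<lambda>_. x k) - ?I) else 0)"
      by (intro sum.cong) auto
    moreover have "ramp_box {k} n q (\<lambda>_. x k) = ramp_box {k} n q x"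
      by (simp add: ramp_box_def)
    ultimately show ?thesis using k by (simp add: marginal_test_def)
  qed
qed auto

text \<open>
  Lowering \<open>\<beta>\<^sub>1\<close> by the uniform surplus \<open>D\<close> keeps the hedge valid and saves \<open>D\<close>. For \<open>a > 0\<close>,
  division by \<open>a\<close> gives a dual point of value at most \<open>c - D / a\<close>. For \<open>a = 0\<close> one obtains a
  hedge of the zero claim at price at most \<open>- D\<close>, which weak duality excludes when a primal point exists.
\<close>

lemma affordable_surplus_not_positive:
  assumes ball: "martingale_ball d \<Omega> \<nu> \<epsilon> \<noteq> {}" and c: "ereal c \<le> dual_value d \<Omega> f \<nu> \<epsilon>"
    and h: "affordable_surplus c h" and D: "0 < D" "\<And>z. z \<in> paths \<times> paths \<Longrightarrow> D \<le> h z"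
  shows False
proof -
  obtain a \<gamma> \<alpha> \<beta> where "surplus_of c h a \<gamma> \<alpha> \<beta>" using h unfolding affordable_surplus_def by blast
  note a = surplus_ofD(1)[OF this] and \<gamma> = surplus_ofD(2)[OF this] and \<alpha> = surplus_ofD(3)[OF this]
    and \<beta> = surplus_ofD(4)[OF this] and eq = surplus_ofD(5)[OF this] and cost = surplus_ofD(6)[OF this]
  define \<beta>' where "\<beta>' k t = \<beta> k t - (if k = 1 then D else 0)" for k and t :: real
  have \<beta>': "continuous_on (\<Omega> k) (\<beta>' k)" if "k \<in> {1..d}" for k
    unfolding \<beta>'_def by (intro continuous_intros \<beta> that)
  have sum': "(\<Sum>k=1..d. \<beta>' k (x k)) = (\<Sum>k=1..d. \<beta> k (x k)) - D" for x
    using d_pos by (simp add: \<beta>'_def sum_subtractf)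
  have "(\<integral>t. \<beta>' k t \<partial>\<nu> k) = (\<integral>t. \<beta> k t \<partial>\<nu> k) - (if k = 1 then D else 0)" if k: "k \<in> {1..d}" for k
  proof -
    interpret prob_space "\<nu> k" by (rule borel_probs_prob_space[OF marginals[OF k]])
    show ?thesis unfolding \<beta>'_def using integrable_marginal[OF k \<beta>[OF k]] by (simp add: prob_space)
  qed
  then have "(\<Sum>k=1..d. \<integral>t. \<beta>' k t \<partial>\<nu> k)
      = (\<Sum>k=1..d. (\<integral>t. \<beta> k t \<partial>\<nu> k) - (if k = 1 then D else 0))"
    by (rule sum.cong[OF refl])
  then have cost': "\<gamma> * \<epsilon> + (\<Sum>k=1..d. \<integral>t. \<beta>' k t \<partial>\<nu> k) \<le> a * c - D"
    using cost d_pos by (simp add: sum_subtractf)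
  have le: "a * f x' + (\<Sum>k\<in>{1..<d}. \<alpha> k (restrict x' {1..k}) * (x' (Suc k) - x' k))
      - \<gamma> * l1_dist d x x' - (\<Sum>k=1..d. \<beta>' k (x k)) \<le> 0" if "x \<in> paths" "x' \<in> paths" for x x'
    using D(2)[of "(x, x')"] eq[OF that] that unfolding sum' by simp
  show False
  proof (cases "a = 0")
    case True
    obtain p where p: "p \<in> martingale_ball d \<Omega> \<nu> \<epsilon>" using ball by blast
    have "(\<gamma>, \<alpha>, \<beta>') \<in> dual_feasible d \<Omega> (\<lambda>_. 0)"
      unfolding dual_feasible_def using \<gamma> \<alpha> \<beta>' le True by simp
    from weak_duality[OF continuous_on_const _ this p] show False
      using cost' True D(1) eps_pos by simp
  next
    case False
    with a have a: "0 < a" by simp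
    let ?\<alpha> = "\<lambda>k x. \<alpha> k x / a" and ?\<beta> = "\<lambda>k t. \<beta>' k t / a"
    have "(\<gamma> / a, ?\<alpha>, ?\<beta>) \<in> dual_feasible d \<Omega> f"
      unfolding dual_feasible_def
    proof (rule CollectI, simp only: case_prod_conv, intro conjI ballI)
      show "0 \<le> \<gamma> / a" using \<gamma> a by simp
      show "continuous_on (omega_prod k \<Omega>) (?\<alpha> k)" if "k \<in> {1..<d}" for k
        using a by (intro continuous_intros \<alpha> that) auto
      show "continuous_on (\<Omega> k) (?\<beta> k)" if "k \<in> {1..d}" for k
        using a by (intro continuous_intros \<beta>' that) auto
      fix x x' assume x: "x \<in> paths" "x' \<in> paths"
      have "(a * f x' + (\<Sum>k\<in>{1..<d}. \<alpha> k (restrict x' {1..k}) * (x' (Suc k) - x' k))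
          - \<gamma> * l1_dist d x x' - (\<Sum>k=1..d. \<beta>' k (x k))) / a \<le> 0"
        using le[OF x] a by (simp add: divide_le_0_iff)
      then show "f x' + (\<Sum>k\<in>{1..<d}. \<alpha> k (restrict x' {1..k}) / a * (x' (Suc k) - x' k))
          - \<gamma> / a * l1_dist d x x' - (\<Sum>k=1..d. \<beta>' k (x k) / a) \<le> 0"
        using a by (simp add: add_divide_distrib diff_divide_distrib sum_divide_distrib)
    qed
    then have "dual_value d \<Omega> f \<nu> \<epsilon> \<le> ereal (\<gamma> / a * \<epsilon> + (\<Sum>k=1..d. \<integral>t. ?\<beta> k t \<partial>\<nu> k))"
      unfolding dual_value_def by (rule INF_lower2) simp
    from order_trans[OF c this] have "c \<le> \<gamma> / a * \<epsilon> + (\<Sum>k=1..d. \<integral>t. ?\<beta> k t \<partial>\<nu> k)"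
      unfolding ereal_less_eq(3) .
    also have "\<dots> = (\<gamma> * \<epsilon> + (\<Sum>k=1..d. \<integral>t. \<beta>' k t \<partial>\<nu> k)) / a"
      by (simp add: add_divide_distrib sum_divide_distrib)
    also have "\<dots> \<le> (a * c - D) / a" using cost' a by (intro divide_right_mono) auto
    also have "\<dots> < c" using a D(1) by (simp add: field_simps)
    finally show False by simp
  qed
qed

section \<open>Strong duality\<close>

text \<open>
  The law of the second path is the primal point; the law of the first is the measure with
  marginals \<open>\<nu>\<close> near it, and the plan, with its components swapped, is a coupling of the two.
\<close>

lemma primal_from_plan:
  assumes m: "m \<in> borel_probs (paths \<times> paths)"
    and cost: "(\<integral>z. l1_dist d (fst z) (snd z) \<partial>m) \<le> \<epsilon>"
    and marg: "\<And>k n q. k \<in> {1..d} \<Longrightarrow> q \<in> PiE {k} (\<lambda>_. \<rat>) \<Longrightarrow> (\<integral>z. marginal_test 1 k n q z \<partial>m) = 0"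
    and mart: "\<And>k n q. k \<in> {1..<d} \<Longrightarrow> q \<in> PiE {1..k} (\<lambda>_. \<rat>) \<Longrightarrow>
      (\<integral>z. martingale_test 1 k n q z \<partial>m) = 0"
  shows "\<exists>p\<in>martingale_ball d \<Omega> \<nu> \<epsilon>. (\<integral>x. f x \<partial>p) = (\<integral>z. f (snd z) \<partial>m)"
proof -
  interpret m: prob_space m by (rule borel_probs_prob_space[OF m])
  have space: "space m = paths \<times> paths" by (rule borel_probs_space[OF m])
  have compact: "compact (paths \<times> paths)" by (rule compact_Times[OF compact_paths compact_paths])
  let ?B = "restrict_space borel paths :: (nat \<Rightarrow> real) measure"
  have fst_B: "fst \<in> measurable m ?B" and snd_B: "snd \<in> measurable m ?B"
    by (intro measurable_restrict_space2 borel_probs_continuous_measurable[OF m]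
        continuous_on_fst continuous_on_snd continuous_on_id; auto simp: space)+
  define p where "p = distr m ?B snd"
  define p' where "p' = distr m ?B fst"
  have p: "p \<in> borel_probs paths" unfolding p_def borel_probs_def
    by (auto intro: m.prob_space_distr[OF snd_B])
  have p': "p' \<in> borel_probs paths" unfolding p'_def borel_probs_def
    by (auto intro: m.prob_space_distr[OF fst_B])
  have snd_p: "snd \<in> measurable m p" and fst_p': "fst \<in> measurable m p'"
    using fst_B snd_B by (simp_all add: p_def p'_def)
  have int_p: "(\<integral>x. g x \<partial>p) = (\<integral>z. g (snd z) \<partial>m)" if "continuous_on paths g" for g :: "(nat \<Rightarrow> real) \<Rightarrow> real"
    unfolding p_def by (rule integral_distr[OF snd_B borel_measurable_continuous_on_restrict[OF that]])
  have "p \<in> martingale_measures d \<Omega>"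
    unfolding martingale_measures_def
  proof (intro CollectI conjI ballI p)
    fix k assume k: "k \<in> {1..<d}"
    show "AE x in p. real_cond_exp p (coord_algebra paths k) (\<lambda>x. x (Suc k)) x = x k"
    proof (rule martingale_from_ramp_boxes[OF p k])
      fix n and q :: "nat \<Rightarrow> real" assume q: "q \<in> PiE {1..k} (\<lambda>_. \<rat>)"
      show "(\<integral>x. ramp_box {1..k} n q x * (x (Suc k) - x k) \<partial>p) = 0"
        using mart[OF k q, of n]
        by (subst int_p) (auto intro!: continuous_intros continuous_ramp_box simp: martingale_test_def)
    qed
  qed
  moreover have "p' \<in> with_marginals d \<Omega> \<nu>"
    unfolding with_marginals_def
  proof (intro CollectI conjI ballI p')
    fix k assume k: "k \<in> {1..d}"
    interpret \<nu>: prob_space "\<nu> k" by (rule borel_probs_prob_space[OF marginals[OF k]])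
    have in_k: "x k \<in> \<Omega> k" if "x \<in> paths" for x using that k by (auto simp: omega_prod_def)
    \<comment> \<open>one-dimensional laws are compared as measures on functions with the single index \<open>k\<close>, where the ramp criterion applies\<close>
    let ?P = "PiM {k} (\<lambda>_. borel :: real measure)"
    have X: "(\<lambda>x. x k) \<in> measurable p' (restrict_space borel (\<Omega> k))"
      using measurable_coordinate[OF p'] in_k
      by (intro measurable_restrict_space2) (auto simp: borel_probs_space[OF p'])
    have id: "(\<lambda>t. t) \<in> borel_measurable (\<nu> k)"
      by (rule borel_probs_continuous_measurable[OF marginals[OF k] continuous_on_id])
    have emb: "(\<lambda>t. \<lambda>i\<in>{k}. t) \<in> measurable (\<nu> k) ?P" by (intro measurable_restrict id)
    have res: "(\<lambda>x. restrict x {k}) \<in> measurable p' ?P"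
      by (rule measurable_restrict_coordinates[OF p'])
    have eq: "distr p' ?P (\<lambda>x. restrict x {k}) = distr (\<nu> k) ?P (\<lambda>t. \<lambda>i\<in>{k}. t)"
    proof (rule finite_measure_eqI_ramp_box)
      interpret p': prob_space p' by (rule borel_probs_prob_space[OF p'])
      show "finite_measure (distr p' ?P (\<lambda>x. restrict x {k}))"
        by (rule p'.finite_measure_distr[OF res])
      show "finite_measure (distr (\<nu> k) ?P (\<lambda>t. \<lambda>i\<in>{k}. t))"
        by (rule \<nu>.finite_measure_distr[OF emb])
      fix n and q :: "nat \<Rightarrow> real" assume q: "q \<in> PiE {k} (\<lambda>_. \<rat>)"
      have "(\<integral>x. ramp_box {k} n q x \<partial>distr p' ?P (\<lambda>x. restrict x {k})) = (\<integral>x. ramp_box {k} n q x \<partial>p')"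
        by (subst integral_distr[OF res measurable_ramp_box]) simp
      also have "\<dots> = (\<integral>z. ramp_box {k} n q (fst z) \<partial>m)"
        unfolding p'_def
        by (rule integral_distr[OF fst_B borel_measurable_continuous_on_restrict[OF continuous_ramp_box]])
      also have "\<dots> = (\<integral>t. ramp_box {k} n q (\<lambda>_. t) \<partial>\<nu> k)"
      proof -
        have "integrable m (\<lambda>z. ramp_box {k} n q (fst z))"
          by (intro continuous_integrable_borel_probs[OF compact m]
              continuous_on_compose2[OF continuous_ramp_box[of UNIV]]
              continuous_on_fst continuous_on_id subset_UNIV)
        then show ?thesis
          using marg[OF k q, of n] by (simp add: marginal_test_def m.prob_space)
      qed
      also have "\<dots> = (\<integral>x. ramp_box {k} n q x \<partial>distr (\<nu> k) ?P (\<lambda>t. \<lambda>i\<in>{k}. t))"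
        by (subst integral_distr[OF emb measurable_ramp_box]) (simp add: ramp_box_def)
      finally show "(\<integral>x. ramp_box {k} n q x \<partial>distr p' ?P (\<lambda>x. restrict x {k}))
        = (\<integral>x. ramp_box {k} n q x \<partial>distr (\<nu> k) ?P (\<lambda>t. \<lambda>i\<in>{k}. t))" .
    qed auto
    show "distr p' (restrict_space borel (\<Omega> k)) (\<lambda>x. x k) = \<nu> k"
    proof (rule measure_eqI)
      show "sets (distr p' (restrict_space borel (\<Omega> k)) (\<lambda>x. x k)) = sets (\<nu> k)"
        using borel_probs_sets[OF marginals[OF k]] by simp
      fix A assume "A \<in> sets (distr p' (restrict_space borel (\<Omega> k)) (\<lambda>x. x k))"
      then have A: "A \<in> sets (restrict_space borel (\<Omega> k))" by simp
      have "closed (\<Omega> k)" using compact_interval[OF k] by (rule compact_imp_closed)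
      then have Ab: "A \<in> sets borel" "A \<subseteq> \<Omega> k"
        using A by (auto simp: sets_restrict_space_iff)
      let ?C = "{x \<in> space ?P. x k \<in> A}"
      have "(\<lambda>x. x k) \<in> measurable ?P (borel :: real measure)" by (rule measurable_component_singleton) simp
      from measurable_sets[OF this Ab(1)] have C: "?C \<in> sets ?P" by (simp add: vimage_def Int_def conj_commute)
      have "emeasure (distr p' (restrict_space borel (\<Omega> k)) (\<lambda>x. x k)) A
          = emeasure (distr p' ?P (\<lambda>x. restrict x {k})) ?C"
        unfolding emeasure_distr[OF X A] emeasure_distr[OF res C]
        by (rule arg_cong[where f = "emeasure p'"]) (auto simp: space_PiM)
      also have "\<dots> = emeasure (distr (\<nu> k) ?P (\<lambda>t. \<lambda>i\<in>{k}. t)) ?C" unfolding eq ..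
      also have "\<dots> = emeasure (\<nu> k) A"
        unfolding emeasure_distr[OF emb C]
        by (rule arg_cong[where f = "emeasure (\<nu> k)"])
          (use Ab in \<open>auto simp: space_PiM borel_probs_space[OF marginals[OF k]]\<close>)
      finally show "emeasure (distr p' (restrict_space borel (\<Omega> k)) (\<lambda>x. x k)) A = emeasure (\<nu> k) A" .
    qed
  qed
  moreover have "wasserstein d p p' \<le> ennreal \<epsilon>"
  proof -
    let ?swap = "\<lambda>z. (snd z, fst z)"
    have swap: "?swap \<in> measurable m (p \<Otimes>\<^sub>M p')" by (intro measurable_Pair snd_p fst_p')
    define \<kappa> where "\<kappa> = distr m (p \<Otimes>\<^sub>M p') ?swap"
    have "distr \<kappa> p fst = p"
      unfolding \<kappa>_def by (subst distr_distr[OF measurable_fst swap])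
        (auto simp: comp_def p_def intro!: distr_cong)
    moreover have "distr \<kappa> p' snd = p'"
      unfolding \<kappa>_def by (subst distr_distr[OF measurable_snd swap])
        (auto simp: comp_def p'_def intro!: distr_cong)
    ultimately have \<kappa>: "\<kappa> \<in> couplings p p'"
      unfolding couplings_def by (auto simp: \<kappa>_def intro: m.prob_space_distr[OF swap])
    have int: "integrable m (\<lambda>z. l1_dist d (fst z) (snd z))"
      unfolding l1_dist_def
      by (intro continuous_integrable_borel_probs[OF compact m] continuous_intros)
    have "(\<integral>\<^sup>+ z. ennreal (l1_dist d (fst z) (snd z)) \<partial>\<kappa>)
        = (\<integral>\<^sup>+ z. ennreal (l1_dist d (snd z) (fst z)) \<partial>m)"
    proof -
      have "(\<lambda>z. ennreal (l1_dist d (fst z) (snd z))) \<in> borel_measurable \<kappa>"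
        using measurable_compose[OF measurable_l1_dist[OF p p'] measurable_ennreal]
        by (simp add: \<kappa>_def)
      then show ?thesis
        unfolding \<kappa>_def by (subst nn_integral_distr[OF swap]) simp_all
    qed
    also have "\<dots> = (\<integral>\<^sup>+ z. ennreal (l1_dist d (fst z) (snd z)) \<partial>m)"
      by (simp add: l1_dist_commute)
    also have "\<dots> = ennreal (\<integral>z. l1_dist d (fst z) (snd z) \<partial>m)"
      by (rule nn_integral_eq_integral[OF int]) (simp add: l1_dist_nonneg)
    also have "\<dots> \<le> ennreal \<epsilon>" using cost by (rule ennreal_leI)
    finally show ?thesis
      unfolding wasserstein_def by (rule INF_lower2[OF \<kappa>])
  qed
  ultimately have "p \<in> martingale_ball d \<Omega> \<nu> \<epsilon>"
    unfolding martingale_ball_def dist_to_marginals_def by (auto intro: INF_lower2)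
  then show ?thesis using int_p[OF continuous_f] by blast
qed

text \<open>
  With \<open>c\<close> the dual value itself, this already contains both the missing inequality and the existence of
  an optimizer.
\<close>

theorem primal_attains:
  assumes ball: "martingale_ball d \<Omega> \<nu> \<epsilon> \<noteq> {}" and c: "ereal c \<le> dual_value d \<Omega> f \<nu> \<epsilon>"
  shows "\<exists>p\<in>martingale_ball d \<Omega> \<nu> \<epsilon>. c \<le> (\<integral>x. f x \<partial>p)"
proof -
  define H where "H = {\<lambda>z. c - f (snd z), \<lambda>z. l1_dist d (fst z) (snd z) - \<epsilon>}
    \<union> (\<Union>s\<in>{1, -1}. \<Union>k\<in>{1..<d}. \<Union>n. martingale_test s k n ` PiE {1..k} (\<lambda>_. \<rat>))
    \<union> (\<Union>s\<in>{1, -1}. \<Union>k\<in>{1..d}. \<Union>n. marginal_test s k n ` PiE {k} (\<lambda>_. \<rat>))"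
  have countable: "countable H"
    unfolding H_def
    by (intro countable_Un countable_UN countable_image countable_PiE)
      (auto simp: countable_rat)
  have cf: "continuous_on (paths \<times> paths) (\<lambda>z. f (snd z))"
    by (rule continuous_on_compose2[OF continuous_f]) (auto intro: continuous_on_snd continuous_on_id)
  have cl: "continuous_on (paths \<times> paths) (\<lambda>z. l1_dist d (fst z) (snd z))"
    unfolding l1_dist_def by (intro continuous_intros)
  have cmart: "continuous_on (paths \<times> paths) (martingale_test s k n q)" for s k n q
    unfolding martingale_test_def ramp_box_def by (intro continuous_intros)
  have cmarg: "continuous_on (paths \<times> paths) (marginal_test s k n q)" for s k n q
    unfolding marginal_test_def ramp_box_def by (intro continuous_intros)
  have cont: "continuous_on (paths \<times> paths) h" if "h \<in> H" for h
    using that cmart cmarg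
    unfolding H_def by (auto intro!: continuous_on_diff cf cl continuous_on_const)
  have hedge: "affordable_surplus c h" if "h \<in> H" for h
    using that affordable_surplus_payoff affordable_surplus_transport_cost affordable_surplus_martingale_test
      affordable_surplus_marginal_test
    unfolding H_def by auto
  have nonempty: "paths \<times> paths \<noteq> {}" using paths_nonempty by auto
  have no: "\<not> (\<exists>F w D. finite F \<and> F \<subseteq> H \<and> 0 < D \<and> (\<forall>h\<in>F. 0 \<le> w h) \<and>
      (\<forall>z\<in>paths \<times> paths. D \<le> (\<Sum>h\<in>F. w h * h z)))"
  proof clarify
    fix F w and D :: real
    assume F: "finite F" "F \<subseteq> H" and D: "0 < D" and w: "\<forall>h\<in>F. 0 \<le> w h"
      and le: "\<forall>z\<in>paths \<times> paths. D \<le> (\<Sum>h\<in>F. w h * h z)"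
    have "affordable_surplus c (\<lambda>z. \<Sum>h\<in>F. w h * h z)"
      by (rule affordable_surplus_sum[OF F(1)]) (use F(2) hedge w in auto)
    from affordable_surplus_not_positive[OF ball c this D] le show False by blast
  qed
  obtain m where m: "m \<in> borel_probs (paths \<times> paths)" and neg: "\<And>h. h \<in> H \<Longrightarrow> (\<integral>z. h z \<partial>m) \<le> 0"
    using ville_alternative_countable[OF parametrizable_paths_Times nonempty countable cont] no
    by blast
  interpret m: prob_space m by (rule borel_probs_prob_space[OF m])
  have compact: "compact (paths \<times> paths)" by (rule compact_Times[OF compact_paths compact_paths])
  note integrable = continuous_integrable_borel_probs[OF compact m]
  have "(\<integral>z. c - f (snd z) \<partial>m) \<le> 0" by (rule neg) (simp add: H_def)
  then have payoff: "c \<le> (\<integral>z. f (snd z) \<partial>m)"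
    using integrable[OF cf] by (simp add: m.prob_space)
  have "(\<integral>z. l1_dist d (fst z) (snd z) - \<epsilon> \<partial>m) \<le> 0" by (rule neg) (simp add: H_def)
  then have cost: "(\<integral>z. l1_dist d (fst z) (snd z) \<partial>m) \<le> \<epsilon>"
    using integrable[OF cl] by (simp add: m.prob_space)
  have marg: "(\<integral>z. marginal_test 1 k n q z \<partial>m) = 0" if k: "k \<in> {1..d}" and q: "q \<in> PiE {k} (\<lambda>_. \<rat>)"
    for k n q
  proof -
    have "marginal_test s k n q \<in> H" if s: "s \<in> {1, -1}" for s
      unfolding H_def by (intro UnI2 UN_I[OF s] UN_I[OF k] UN_I[where a = n, OF UNIV_I] imageI q)
    from neg[OF this, of 1] neg[OF this, of "-1"]
    have "(\<integral>z. marginal_test 1 k n q z \<partial>m) \<le> 0" "(\<integral>z. marginal_test (-1) k n q z \<partial>m) \<le> 0"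
      by simp_all
    moreover have "marginal_test (-1) k n q = (\<lambda>z. - marginal_test 1 k n q z)"
      by (simp add: marginal_test_def fun_eq_iff)
    ultimately show ?thesis by simp
  qed
  have mart: "(\<integral>z. martingale_test 1 k n q z \<partial>m) = 0"
    if k: "k \<in> {1..<d}" and q: "q \<in> PiE {1..k} (\<lambda>_. \<rat>)" for k n q
  proof -
    have "martingale_test s k n q \<in> H" if s: "s \<in> {1, -1}" for s
      unfolding H_def
      by (rule UnI1) (intro UnI2 UN_I[OF s] UN_I[OF k] UN_I[where a = n, OF UNIV_I] imageI q)
    from neg[OF this, of 1] neg[OF this, of "-1"]
    have "(\<integral>z. martingale_test 1 k n q z \<partial>m) \<le> 0" "(\<integral>z. martingale_test (-1) k n q z \<partial>m) \<le> 0"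
      by simp_all
    moreover have "martingale_test (-1) k n q = (\<lambda>z. - martingale_test 1 k n q z)"
      by (simp add: martingale_test_def fun_eq_iff)
    ultimately show ?thesis by simp
  qed
  have "\<exists>p\<in>martingale_ball d \<Omega> \<nu> \<epsilon>. (\<integral>x. f x \<partial>p) = (\<integral>z. f (snd z) \<partial>m)"
    by (rule primal_from_plan[OF m cost marg mart])
  then obtain p where "p \<in> martingale_ball d \<Omega> \<nu> \<epsilon>" "(\<integral>x. f x \<partial>p) = (\<integral>z. f (snd z) \<partial>m)"
    by (elim bexE) (rule that)
  with payoff show ?thesis by (intro bexI[of _ p]) simp_all
qed

theorem strong_duality:
  assumes ball: "martingale_ball d \<Omega> \<nu> \<epsilon> \<noteq> {}"
  shows "primal_value d \<Omega> f \<nu> \<epsilon> = dual_value d \<Omega> f \<nu> \<epsilon> \<and>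
    (\<exists>p\<in>martingale_ball d \<Omega> \<nu> \<epsilon>. ereal (\<integral>x. f x \<partial>p) = primal_value d \<Omega> f \<nu> \<epsilon>)"
proof -
  let ?J = "dual_value d \<Omega> f \<nu> \<epsilon>"
  have weak: "ereal (\<integral>x. f x \<partial>p) \<le> ?J" if p: "p \<in> martingale_ball d \<Omega> \<nu> \<epsilon>" for p
    unfolding dual_value_def
  proof (rule INF_greatest, clarify)
    fix \<gamma> \<alpha> \<beta> assume "(\<gamma>, \<alpha>, \<beta>) \<in> dual_feasible d \<Omega> f"
    from weak_duality[OF continuous_f less_imp_le[OF eps_pos] this p]
    show "ereal (\<integral>x. f x \<partial>p) \<le> ereal (\<gamma> * \<epsilon> + (\<Sum>k=1..d. \<integral>t. \<beta> k t \<partial>\<nu> k))" by simp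
  qed
  obtain b where b: "\<And>x. x \<in> paths \<Longrightarrow> f x \<le> b"
    using compact_imp_bounded[OF compact_continuous_image[OF continuous_f compact_paths]]
    unfolding bounded_iff by (auto simp: abs_le_iff)
  have f_le: "(\<integral>x. f x \<partial>p) \<le> b" if "p \<in> martingale_ball d \<Omega> \<nu> \<epsilon>" for p
  proof -
    have pb: "p \<in> borel_probs paths"
      using that by (auto simp: martingale_ball_def martingale_measures_def)
    interpret prob_space p by (rule borel_probs_prob_space[OF pb])
    show ?thesis
      by (rule integral_le_const[OF continuous_integrable_borel_probs[OF compact_paths pb continuous_f]])
        (auto intro!: AE_I2 b simp: borel_probs_space[OF pb])
  qed
  have "?J \<noteq> \<infinity>"
  proof
    assume "?J = \<infinity>"
    then have "ereal (b + 1) \<le> ?J" by simp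
    from primal_attains[OF ball this] f_le show False by force
  qed
  moreover have "?J \<noteq> - \<infinity>" using ball weak by force
  ultimately obtain j where j: "?J = ereal j" by (cases ?J) auto
  then obtain p where p: "p \<in> martingale_ball d \<Omega> \<nu> \<epsilon>" "j \<le> (\<integral>x. f x \<partial>p)"
    using primal_attains[OF ball, of j] by auto
  have pJ: "ereal (\<integral>x. f x \<partial>p) = ?J"
    using p(2) weak[OF p(1)] by (intro antisym) (simp_all add: j)
  have "primal_value d \<Omega> f \<nu> \<epsilon> = ?J"
    unfolding primal_value_def
  proof (rule antisym)
    show "(SUP p\<in>martingale_ball d \<Omega> \<nu> \<epsilon>. ereal (\<integral>x. f x \<partial>p)) \<le> ?J" by (rule SUP_least) (rule weak)
    show "?J \<le> (SUP p\<in>martingale_ball d \<Omega> \<nu> \<epsilon>. ereal (\<integral>x. f x \<partial>p))"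
      using SUP_upper[OF p(1), of "\<lambda>p. ereal (\<integral>x. f x \<partial>p)"] by (simp add: pJ)
  qed
  then show ?thesis using p(1) pJ by auto
qed

end

theorem theorem1:
  fixes d :: nat
    and \<Omega> :: "nat \<Rightarrow> real set"
    and f :: "(nat \<Rightarrow> real) \<Rightarrow> real"
    and \<nu> :: "nat \<Rightarrow> real measure"
    and \<epsilon> :: real
  assumes "1 \<le> d"
    and "\<forall>k\<in>{1..d}. \<exists>a b. a \<le> b \<and> \<Omega> k = {a..b}"
    and "\<forall>k\<in>{1..<d}. \<Omega> k \<subseteq> \<Omega> (Suc k)"
    and "continuous_on ({1..d} \<rightarrow>\<^sub>E UNIV) f"
    and "\<forall>k\<in>{1..d}. \<nu> k \<in> borel_probs (\<Omega> k)"
    and "0 < \<epsilon>"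
    and "martingale_ball d \<Omega> \<nu> \<epsilon> \<noteq> {}"
  shows "primal_value d \<Omega> f \<nu> \<epsilon> = dual_value d \<Omega> f \<nu> \<epsilon> \<and>
    (\<exists>\<pi>\<in>martingale_ball d \<Omega> \<nu> \<epsilon>. ereal (\<integral>x. f x \<partial>\<pi>) = primal_value d \<Omega> f \<nu> \<epsilon>)"
proof -
  have "continuous_on (omega_prod d \<Omega>) f"
    by (rule continuous_on_subset[OF assms(4)]) (auto simp: omega_prod_def PiE_def)
  then interpret robust_martingale_transport d \<Omega> f \<nu> \<epsilon>
    using assms by unfold_locales auto
  show ?thesis by (rule strong_duality[OF assms(7)])
qed

end
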